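(* In the setting of the context (problem $F=f+h$, algorithm Ada-BPSG, restart scheme, standing assumptions 1--6), suppose that $\eta_{\max}\le \frac{1}{\bar L+32\sigma_b M/b}$, that within each restart round the step sizes of Ada-BPSG satisfy $\eta_{\min}\le\eta_k\le\eta_{\max}$ and $\eta_k\ge\eta_{k-1}$, and that $F$ satisfies, for some $\mu>0$, the relative quadratic growth condition $$F(x)-F(x^* )\ge \mu D_\psi(x^*,x),\qquad x\in D.$$ Let $A_b:=\frac{n}{4b}+\frac12$. Starting from $x^{(0)}$, let each restart round $t=0,1,2,\dots$ reinitialize the gradient table at $x^{(t)}$, start or continue with a step size in $[\eta_{\min},\eta_{\max}]$, run Ada-BPSG from $x^{(t)}$ for $$K\ge 4\left(A_b+\frac{1}{\mu\eta_{\min}}\right)$$ iterations, and set $x^{(t+1)}$ to the averaged iterate $\frac1K\sum_{k=1}^K x_k$ of round $t$. Then after $\tau$ restart rounds, $$\mathbb{E}[F(x^{(\tau)})]-F(x^* )\le 2^{-\tau}\bigl(F(x^{(0)})-F(x^* )\bigr).$$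
   Context: **Setting.** $\mathbf{E}$ is a finite-dimensional real normed space with norm $\|\cdot\|$, dual space $\mathbf{E}^*$, duality pairing $\langle\cdot,\cdot\rangle$ and dual norm $\|y\|_*=\max\{\langle y,x\rangle:\|x\|\le 1\}$. Let $n\ge1$, $[n]=\{1,\dots,n\}$, $f_i:\mathbf{E}\to\mathbb{R}$ for $i\in[n]$, $f=\frac1n\sum_{i=1}^n f_i$, $h:\mathbf{E}\to(-\infty,+\infty]$, and $F=f+h$, to be minimized over $\mathbf{E}$. $\mathcal{X}\subset\mathbf{E}$ is a nonempty, convex, open set on which the $f_i$ are differentiable and $f$ is lower semicontinuous and continuously differentiable. Gradients are elements of $\mathbf{E}^*$. For $\psi:\mathbf{E}\to\mathbb{R}$ differentiable, $D_\psi(x,y)=\psi(x)-\psi(y)-\langle\nabla\psi(y),x-y\rangle$. **Algorithm Ada-BPSG.** Parameters: batch size $b\in\{1,\dots,n\}$, initial point $x_0$, bounds $0<\eta_{\min}\le\eta_{\max}$, initial step size $\eta_0\in[\eta_{\min},\eta_{\max}]$, update frequency $m\ge1$ (an integer), $\alpha>0$, $\theta>0$. Initialize $\phi_i^0=x_0$ for all $i$, $\mu_0=\frac1n\sum_i\nabla f_i(\phi_i^0)$, $\xi_0=\delta_0=0$. For $k=0,1,2,\dots$: (i) If $k>0$, set $\eta_k=\eta_{k-1}$. If moreover $k \bmod m=0$, let $\widehat\eta_k=\frac1\alpha\frac{\xi_k}{\delta_k+\theta\xi_k}$ if $\xi_k>0$ and $\widehat\eta_k=\eta_{k-1}$ if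 $\xi_k=0$; set $\eta_k=\max\{\eta_{k-1},\min\{\eta_{\max},\max\{\eta_{\min},\widehat\eta_k\}\}\}$; then reset $\xi_k=\delta_k=0$. (ii) Draw a batch $B_k\subset[n]$ of size $b$ uniformly without replacement. Set $\phi_i^{k+1}=x_k$ for $i\in B_k$ and $\phi_i^{k+1}=\phi_i^k$ for $i\notin B_k$. (iii) $\widetilde\nabla_k=\frac1b\sum_{i\in B_k}(\nabla f_i(\phi_i^{k+1})-\nabla f_i(\phi_i^k))+\mu_k$. (iv) $x_{k+1}=\arg\min_x\{h(x)+\langle\widetilde\nabla_k,x\rangle+\frac1{\eta_k}D_\psi(x,x_k)\}$. (v) With $y_i=\nabla f_i(\phi_i^{k+1})-\nabla f_i(\phi_i^k)$ and $s_i=\phi_i^{k+1}-\phi_i^k$, set $\xi_{k+1}=\xi_k+\sum_{i\in B_k}|\langle y_i,s_i\rangle|$, $\delta_{k+1}=\delta_k+\sum_{i\in B_k}\|y_i\|_*^2$, $\mu_{k+1}=\mu_k+\frac1n\sum_{i\in B_k}y_i$. **Restart scheme.** Round $t$ is a run of Ada-BPSG with initial point $x_0=x^{(t)}$ (so all $\phi_i^0=x^{(t)}$), whose initial step size is any value in $[\eta_{\min},\eta_{\max}]$ determined by the history of previous rounds (for instance a fixed value, or the last step size of the previous round). The initial point $x^{(0)}$ is deterministic. In each round, $\mathcal{F}_k$ denotes the $\sigma$-algebra generated by all batches drawn before iteration $k$ of that round (including those of previous rounds). Assumptions 1--6 below hold for every round, with the same $D$, $x^*$ and constants. **Standing assumptions.**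 1. $\psi$ is continuously differentiable and 1-strongly convex: $D_\psi(x,y)\ge\frac12\|x-y\|^2$ for all $x,y$. $h$ is proper, closed and convex. For every $x\in D$ ($D$ as in 2), $\mathcal{G}\in\mathbf{E}^*$, $\eta\in[\eta_{\min},\eta_{\max}]$, the problem $\min_u\{\langle\mathcal{G},u\rangle+\frac1\eta D_\psi(u,x)+h(u)\}$ has a unique solution. 2. There is a deterministic bounded convex set $D\subset\mathcal{X}$ with $x_k,\phi_i^k\in D$ almost surely for all $k,i$; moreover a minimizer $x^*$ of $F$ over $\mathbf{E}$ belongs to $D$. 3. Conditionally on $\mathcal{F}_k$, $B_k$ is uniform of size $b$ without replacement from $[n]$. There is a deterministic constant $\sigma_b\ge1$ such that, writing $I_1,\dots,I_b$ for the sampled indices, for all deterministic $v_1,\dots,v_n\in\mathbf{E}^*$ with $\bar v=\frac1n\sum_i v_i$, $\mathbb{E}\bigl[\|\frac1b\sum_{j=1}^b(v_{I_j}-\bar v)\|_*^2\bigr]\le\frac{\sigma_b}{bn}\sum_{i=1}^n\|v_i-\bar v\|_*^2$. 4. There are constants $\bar L>0$, $\underline{L}\ge0$ with $-\underline{L}D_\psi(x,y)\le f(x)-f(y)-\langle\nabla f(y),x-y\rangle\le\bar L D_\psi(x,y)$ for all $x,y\in D$. 5. There is a deterministic constant $M\ge0$ with $\|\nabla f_i(x)-\nabla f_i(y)\|_*\le M\|x-y\|$ for all $x,y\in D$, $i\in[n]$. 6. Each $f_i$ is convex on $D$ and $\|\nabla f_i(x)-\nabla f_i(y)\|_*^2\le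 2M\bigl(f_i(x)-f_i(y)-\langle\nabla f_i(y),x-y\rangle\bigr)$ for all $x,y\in D$. *)

theory Defs
  imports "HOL-Probability.Probability"
begin

section \<open>The composite problem\<close>

text \<open>
  The dual space is the type of bounded linear functionals \<open>'a \<Rightarrow>\<^sub>L real\<close>; its norm is the operator
  norm, i.e. the dual norm. Every linear functional is bounded because the space is assumed to be
  finite-dimensional. \<open>grad f x\<close> is meaningful only where \<open>f\<close> is differentiable.
\<close>

definition grad :: "('a::real_normed_vector \<Rightarrow> real) \<Rightarrow> 'a \<Rightarrow> 'a \<Rightarrow>\<^sub>L real" where
  "grad f x = Blinfun (frechet_derivative f (at x))"

definition bregman :: "('a::real_normed_vector \<Rightarrow> real) \<Rightarrow> 'a \<Rightarrow> 'a \<Rightarrow> real" where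
  "bregman psi x y = psi x - psi y - blinfun_apply (grad psi y) (x - y)"

definition avg_fun :: "nat \<Rightarrow> (nat \<Rightarrow> 'a \<Rightarrow> real) \<Rightarrow> 'a \<Rightarrow> real" where
  "avg_fun n fs x = (1 / real n) * (\<Sum>i=1..n. fs i x)"

definition composite :: "nat \<Rightarrow> (nat \<Rightarrow> 'a \<Rightarrow> real) \<Rightarrow> ('a \<Rightarrow> ereal) \<Rightarrow> 'a \<Rightarrow> ereal" where
  "composite n fs h x = ereal (avg_fun n fs x) + h x"

definition lsc_on :: "'a::topological_space set \<Rightarrow> ('a \<Rightarrow> real) \<Rightarrow> bool" where
  "lsc_on X f \<longleftrightarrow> (\<forall>x\<in>X. ereal (f x) \<le> Liminf (at x within X) (\<lambda>y. ereal (f y)))"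

definition ereal_epigraph :: "('a \<Rightarrow> ereal) \<Rightarrow> ('a \<times> real) set" where
  "ereal_epigraph h = {(x, r). h x \<le> ereal r}"

definition proper_closed_convex :: "('a::real_normed_vector \<Rightarrow> ereal) \<Rightarrow> bool" where
  "proper_closed_convex h \<longleftrightarrow>
     (\<forall>x. h x \<noteq> -\<infinity>) \<and> (\<exists>x. h x \<noteq> \<infinity>) \<and>
     closed (ereal_epigraph h) \<and> convex (ereal_epigraph h)"

section \<open>The algorithm Ada-BPSG\<close>

text \<open>\<open>prox_objective h psi G eta x\<close> is the function of \<open>u\<close> minimized in the Bregman proximal step.\<close>

definition prox_objective ::
  "('a::real_normed_vector \<Rightarrow> ereal) \<Rightarrow> ('a \<Rightarrow> real) \<Rightarrow> ('a \<Rightarrow>\<^sub>L real) \<Rightarrow> real \<Rightarrow> 'a \<Rightarrow> 'a \<Rightarrow> ereal" where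
  "prox_objective h psi G eta x u =
     h u + ereal (blinfun_apply G u + (1 / eta) * bregman psi u x)"

text \<open>
  A state holds the data at the start of iteration \<open>k\<close>: the iterate, the table of points \<open>\<phi>\<^sub>i\<close>, the
  mean \<open>\<mu>\<close> of the table gradients, the step size, and the accumulators \<open>\<xi>\<close> and \<open>\<delta>\<close>. At the start
  of iteration \<open>k > 0\<close> the stored step size is still that of iteration \<open>k - 1\<close>;
  \<open>update_stepsize k\<close> turns it into that of iteration \<open>k\<close>.
\<close>

record (overloaded) ('a::real_normed_vector) ada_state =
  it_point :: 'a
  it_table :: "nat \<Rightarrow> 'a"
  it_mean :: "'a \<Rightarrow>\<^sub>L real"
  it_eta :: real
  it_xi :: real
  it_delta :: real

definition ada_init ::
  "nat \<Rightarrow> (nat \<Rightarrow> 'a::real_normed_vector \<Rightarrow> real) \<Rightarrow> 'a \<Rightarrow> real \<Rightarrow> 'a ada_state" where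
  "ada_init n fs x0 eta0 =
     \<lparr>it_point = x0, it_table = (\<lambda>i. x0),
      it_mean = (1 / real n) *\<^sub>R (\<Sum>i=1..n. grad (fs i) x0),
      it_eta = eta0, it_xi = 0, it_delta = 0\<rparr>"

definition update_stepsize ::
  "real \<Rightarrow> real \<Rightarrow> nat \<Rightarrow> real \<Rightarrow> real \<Rightarrow> nat \<Rightarrow> 'a::real_normed_vector ada_state \<Rightarrow> 'a ada_state" where
  "update_stepsize eta_min eta_max m alpha theta k s =
     (if k > 0 \<and> k mod m = 0 then
        let eta_hat = (if it_xi s > 0
                       then (1 / alpha) * (it_xi s / (it_delta s + theta * it_xi s))
                       else it_eta s)
        in s\<lparr>it_eta := max (it_eta s) (min eta_max (max eta_min eta_hat)),
             it_xi := 0, it_delta := 0\<rparr>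
      else s)"

definition batch_step ::
  "nat \<Rightarrow> nat \<Rightarrow> (nat \<Rightarrow> 'a::real_normed_vector \<Rightarrow> real) \<Rightarrow> ('a \<Rightarrow> ereal) \<Rightarrow> ('a \<Rightarrow> real) \<Rightarrow>
   nat set \<Rightarrow> 'a ada_state \<Rightarrow> 'a ada_state" where
  "batch_step n b fs h psi S s =
     (let phi = it_table s;
          phi' = (\<lambda>i. if i \<in> S then it_point s else phi i);
          y = (\<lambda>i. grad (fs i) (phi' i) - grad (fs i) (phi i));
          G = (1 / real b) *\<^sub>R (\<Sum>i\<in>S. y i) + it_mean s
      in \<lparr>it_point = arg_min (prox_objective h psi G (it_eta s) (it_point s)) (\<lambda>_. True),
          it_table = phi',
          it_mean = it_mean s + (1 / real n) *\<^sub>R (\<Sum>i\<in>S. y i),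
          it_eta = it_eta s,
          it_xi = it_xi s + (\<Sum>i\<in>S. \<bar>blinfun_apply (y i) (phi' i - phi i)\<bar>),
          it_delta = it_delta s + (\<Sum>i\<in>S. (norm (y i))\<^sup>2)\<rparr>)"

primrec ada_run ::
  "nat \<Rightarrow> nat \<Rightarrow> (nat \<Rightarrow> 'a::real_normed_vector \<Rightarrow> real) \<Rightarrow> ('a \<Rightarrow> ereal) \<Rightarrow> ('a \<Rightarrow> real) \<Rightarrow>
   real \<Rightarrow> real \<Rightarrow> nat \<Rightarrow> real \<Rightarrow> real \<Rightarrow> 'a \<Rightarrow> real \<Rightarrow> (nat \<Rightarrow> nat set) \<Rightarrow> nat \<Rightarrow> 'a ada_state" where
  "ada_run n b fs h psi eta_min eta_max m alpha theta x0 eta0 B 0 = ada_init n fs x0 eta0"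
| "ada_run n b fs h psi eta_min eta_max m alpha theta x0 eta0 B (Suc k) =
     batch_step n b fs h psi (B k)
       (update_stepsize eta_min eta_max m alpha theta k
         (ada_run n b fs h psi eta_min eta_max m alpha theta x0 eta0 B k))"

section \<open>The restart scheme\<close>

text \<open>
  \<open>restart_point \<dots> K x0 eta0 B t\<close> is the initial point of round \<open>t\<close>, where \<open>eta0 t\<close> is the initial
  step size of round \<open>t\<close> and \<open>B t k\<close> is the batch drawn in iteration \<open>k\<close> of round \<open>t\<close>.
\<close>

primrec restart_point ::
  "nat \<Rightarrow> nat \<Rightarrow> (nat \<Rightarrow> 'a::real_normed_vector \<Rightarrow> real) \<Rightarrow> ('a \<Rightarrow> ereal) \<Rightarrow> ('a \<Rightarrow> real) \<Rightarrow>
   real \<Rightarrow> real \<Rightarrow> nat \<Rightarrow> real \<Rightarrow> real \<Rightarrow> nat \<Rightarrow> 'a \<Rightarrow> (nat \<Rightarrow> real) \<Rightarrow> (nat \<Rightarrow> nat \<Rightarrow> nat set) \<Rightarrow>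
   nat \<Rightarrow> 'a" where
  "restart_point n b fs h psi eta_min eta_max m alpha theta K x0 eta0 B 0 = x0"
| "restart_point n b fs h psi eta_min eta_max m alpha theta K x0 eta0 B (Suc t) =
     (1 / real K) *\<^sub>R
       (\<Sum>k=1..K. it_point (ada_run n b fs h psi eta_min eta_max m alpha theta
          (restart_point n b fs h psi eta_min eta_max m alpha theta K x0 eta0 B t)
          (eta0 t) (B t) k))"

definition restart_state ::
  "nat \<Rightarrow> nat \<Rightarrow> (nat \<Rightarrow> 'a::real_normed_vector \<Rightarrow> real) \<Rightarrow> ('a \<Rightarrow> ereal) \<Rightarrow> ('a \<Rightarrow> real) \<Rightarrow>
   real \<Rightarrow> real \<Rightarrow> nat \<Rightarrow> real \<Rightarrow> real \<Rightarrow> nat \<Rightarrow> 'a \<Rightarrow> (nat \<Rightarrow> real) \<Rightarrow> (nat \<Rightarrow> nat \<Rightarrow> nat set) \<Rightarrow>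
   nat \<Rightarrow> nat \<Rightarrow> 'a ada_state" where
  "restart_state n b fs h psi eta_min eta_max m alpha theta K x0 eta0 B t k =
     ada_run n b fs h psi eta_min eta_max m alpha theta
       (restart_point n b fs h psi eta_min eta_max m alpha theta K x0 eta0 B t)
       (eta0 t) (B t) k"

text \<open>
  The sigma-algebra generated by the batches drawn before iteration \<open>k\<close> of round \<open>t\<close>. Every round
  consists of \<open>K\<close> iterations, so an earlier round contributes exactly its first \<open>K\<close> batches.
\<close>

definition batch_history ::
  "'w measure \<Rightarrow> nat \<Rightarrow> (nat \<Rightarrow> nat \<Rightarrow> 'w \<Rightarrow> nat set) \<Rightarrow> nat \<Rightarrow> nat \<Rightarrow> 'w measure" where
  "batch_history P K B t k =
     sigma (space P) {B s j -` {S} \<inter> space P | s j S. (s < t \<and> j < K) \<or> (s = t \<and> j < k)}"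

text \<open>
  Expectation of an extended-real random variable, as the difference of the expectations of its
  positive and negative parts (\<open>e2ennreal\<close> sends negative values to \<open>0\<close>).
\<close>

definition ereal_expectation :: "'w measure \<Rightarrow> ('w \<Rightarrow> ereal) \<Rightarrow> ereal" where
  "ereal_expectation P Z =
     enn2ereal (\<integral>\<^sup>+\<omega>. e2ennreal (Z \<omega>) \<partial>P) - enn2ereal (\<integral>\<^sup>+\<omega>. e2ennreal (- Z \<omega>) \<partial>P)"

end

theory Submission
  imports Defs
begin

text \<open>
  Within a round, let \<open>x\<^sub>k\<close> be the iterates, \<open>gap x = F x - F xstar\<close>, and let the noise be the
  difference between the gradient estimator and the gradient of \<open>f\<close> at \<open>x\<^sub>k\<close>. The proximal step,
  convexity of \<open>f\<close> and relative smoothness bound \<open>gap x\<^sub>k\<^sub>+\<^sub>1\<close> by three terms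
  (\<open>prox_step_progress\<close>): a term linear in the noise, a multiple \<open>b / (64 sigma_b M)\<close> of its squared
  norm, and the decrease of the Bregman distance to \<open>xstar\<close> divided by the step size. The condition
  on \<open>eta_max\<close> leaves just enough of \<open>D\<^sub>\<psi>(x\<^sub>k\<^sub>+\<^sub>1, x\<^sub>k)\<close> to pay for the squared norm.

  The linear term has conditional mean zero, because the estimator is unbiased. By cocoercivity, the
  conditional mean of the weighted squared norm is at most a quarter of
  \<open>D\<^sub>f(x\<^sub>k, xstar) + H\<^sub>k\<close>, where \<open>H\<^sub>k\<close> averages \<open>D\<^sub>f\<^sub>i(\<phi>\<^sub>i, xstar)\<close> over the table
  (\<open>noise_second_moment\<close>). A table entry is replaced by \<open>x\<^sub>k\<close> with probability \<open>b / n\<close>, so \<open>H\<^sub>k\<close>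
  obeys a linear recursion (\<open>table_gap_update\<close>), and its sum over a round is at most
  \<open>n / b\<close> times the initial gap plus the sum of \<open>D\<^sub>f(x\<^sub>k, xstar) \<le> gap x\<^sub>k\<close>. Since the step sizes
  do not decrease, the Bregman distances telescope to \<open>D\<^sub>\<psi>(xstar, x\<^sub>0) / eta_min\<close>, which
  quadratic growth bounds by \<open>gap x\<^sub>0 / (mu eta_min)\<close>. Half of the sum of the expected gaps is
  absorbed on the left, and the lower bound on \<open>K\<close> says exactly that what remains is at most
  \<open>K / 2\<close> times the initial gap (\<open>round_arithmetic\<close>). Jensen's inequality passes to the averaged
  iterate, and induction over the rounds gives the rate.

  Every quantity of the algorithm is a function of finitely many batches, each with finitely many
  values. All random variables are therefore simple functions, and conditioning on the past becomes
  the finite computation of \<open>expectation_batch\<close>: the expectation of \<open>g(B\<^sub>k, Y)\<close>, for \<open>Y\<close> determined by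
  earlier batches, is that of the average of \<open>g(S, Y)\<close> over all batches \<open>S\<close>.
\<close>

section \<open>First-order conditions\<close>

text \<open>
  Convexity enters only through values on a segment, and this lemma turns such bounds into
  first-order conditions: a chord estimate for all small \<open>t\<close> passes to the limit \<open>t \<rightarrow> 0\<close>.
\<close>

lemma directional_derivative_le:
  fixes g :: "'a::real_normed_vector \<Rightarrow> real"
  assumes deriv: "(g has_derivative g') (at u)"
    and bound: "\<And>t. 0 < t \<Longrightarrow> t \<le> 1 \<Longrightarrow> g (u + t *\<^sub>R d) - g u \<le> t * c"
  shows "g' d \<le> c"
proof -
  have "((\<lambda>t. g (u + t *\<^sub>R d)) has_derivative (\<lambda>t. g' (t *\<^sub>R d))) (at 0)"
    by (rule has_derivative_compose[where f = "\<lambda>t. u + t *\<^sub>R d" and g = g, simplified])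
      (auto intro!: derivative_eq_intros simp: deriv)
  moreover have "(\<lambda>t. g' (t *\<^sub>R d)) = (*) (g' d)"
    using deriv has_derivative_bounded_linear[THEN bounded_linear.linear, THEN linear_scale]
    by (fastforce simp: fun_eq_iff)
  ultimately have "((\<lambda>t. g (u + t *\<^sub>R d)) has_field_derivative g' d) (at 0)"
    by (simp add: has_field_derivative_def)
  then have "((\<lambda>t. (g (u + t *\<^sub>R d) - g u) / t) \<longlongrightarrow> g' d) (at_right 0)"
    by (auto simp: has_field_derivative_iff intro: tendsto_mono[OF at_le])
  moreover have "eventually (\<lambda>t. (g (u + t *\<^sub>R d) - g u) / t \<le> c) (at_right 0)"
    using eventually_at_right_less[of "0::real"] eventually_at_right_real[OF zero_less_one]
    by eventually_elim (use bound in \<open>force simp: field_simps\<close>)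
  ultimately show ?thesis
    by (rule tendsto_upperbound) simp
qed

lemma grad_has_derivative:
  assumes "g differentiable (at x)"
  shows "(g has_derivative blinfun_apply (grad g x)) (at x)"
  using assms frechet_derivative_works[of g "at x"]
  by (simp add: grad_def bounded_linear_Blinfun_apply has_derivative_bounded_linear)

lemma grad_eqI:
  assumes "(g has_derivative blinfun_apply G) (at x)"
  shows "grad g x = G"
  unfolding grad_def frechet_derivative_at[OF assms, symmetric] by (rule blinfun_apply_inverse)

lemma convex_on_bregman_nonneg:
  assumes "convex_on C g" "g differentiable (at x)" "x \<in> C" "z \<in> C"
  shows "0 \<le> bregman g z x"
proof -
  have "blinfun_apply (grad g x) (z - x) \<le> g z - g x"
  proof (rule directional_derivative_le[OF grad_has_derivative[OF assms(2)]])
    fix t :: real assume "0 < t" "t \<le> 1"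
    then have "g ((1 - t) *\<^sub>R x + t *\<^sub>R z) \<le> (1 - t) * g x + t * g z"
      using assms by (intro convex_onD) auto
    moreover have "(1 - t) *\<^sub>R x + t *\<^sub>R z = x + t *\<^sub>R (z - x)"
      by (simp add: algebra_simps)
    ultimately show "g (x + t *\<^sub>R (z - x)) - g x \<le> t * (g z - g x)"
      by (simp add: algebra_simps)
  qed
  then show ?thesis by (simp add: bregman_def)
qed

lemma bregman_three_point:
  "blinfun_apply (grad psi u - grad psi x) (z - u) = bregman psi z x - bregman psi z u - bregman psi u x"
  by (simp add: bregman_def blinfun.diff_left blinfun.diff_right)

text \<open>
  The epigraph description of convexity is traded for a real-valued convex function on the effective
  domain, to which Jensen's inequality for finite sums applies.
\<close>

lemma proper_closed_convex_domain:
  assumes "proper_closed_convex h"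
  shows "convex_on {x. h x < \<infinity>} (\<lambda>x. real_of_ereal (h x))"
proof -
  have key: "h ((1 - t) *\<^sub>R x + t *\<^sub>R y) \<le> ereal ((1 - t) * real_of_ereal (h x) + t * real_of_ereal (h y))"
    if "h x < \<infinity>" "h y < \<infinity>" "0 \<le> t" "t \<le> 1" for x y and t :: real
  proof -
    have "(x, real_of_ereal (h x)) \<in> ereal_epigraph h" "(y, real_of_ereal (h y)) \<in> ereal_epigraph h"
      using that assms by (auto simp: ereal_epigraph_def proper_closed_convex_def ereal_real)
    then have "(1 - t) *\<^sub>R (x, real_of_ereal (h x)) + t *\<^sub>R (y, real_of_ereal (h y)) \<in> ereal_epigraph h"
      using assms that by (intro convexD_alt) (auto simp: proper_closed_convex_def)
    then show ?thesis by (simp add: ereal_epigraph_def)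
  qed
  show ?thesis
  proof
    show "convex {x. h x < \<infinity>}"
      using key by (fastforce simp: convex_alt le_less_trans)
    fix t :: real and x y assume *: "0 < t" "t < 1" "x \<in> {x. h x < \<infinity>}" "y \<in> {x. h x < \<infinity>}"
    have "h ((1 - t) *\<^sub>R x + t *\<^sub>R y) \<le> ereal ((1 - t) * real_of_ereal (h x) + t * real_of_ereal (h y))"
      using * by (intro key) auto
    moreover have "h ((1 - t) *\<^sub>R x + t *\<^sub>R y) \<noteq> -\<infinity>"
      using assms by (auto simp: proper_closed_convex_def)
    ultimately show "real_of_ereal (h ((1 - t) *\<^sub>R x + t *\<^sub>R y))
        \<le> (1 - t) * real_of_ereal (h x) + t * real_of_ereal (h y)"
      by (cases "h ((1 - t) *\<^sub>R x + t *\<^sub>R y)") auto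
  qed
qed

text \<open>
  The inclusion \<open>- \<nabla>g(u) \<in> \<partial>h(u)\<close>, stated without subdifferentials. Moving from the
  minimizer \<open>u\<close> towards \<open>z\<close> by a fraction \<open>t\<close>, \<open>h\<close> increases by at most \<open>t (h z - h u)\<close>, so \<open>g\<close>
  cannot decrease faster than that. It is used for the proximal step and for the minimizer of \<open>F\<close>.
\<close>

lemma composite_minimizer_condition:
  assumes h: "proper_closed_convex h"
    and min: "is_arg_min (\<lambda>x. h x + ereal (g x)) (\<lambda>_. True) u"
    and g: "(g has_derivative g') (at u)"
  shows "h u < \<infinity>"
    and "h z < \<infinity> \<Longrightarrow> real_of_ereal (h u) - g' (z - u) \<le> real_of_ereal (h z)"
proof -
  have le: "h u + ereal (g u) \<le> h x + ereal (g x)" for x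
    using min by (auto simp: is_arg_min_def not_less)
  obtain x where "h x \<noteq> \<infinity>" using h by (auto simp: proper_closed_convex_def)
  with le[of x] show u: "h u < \<infinity>" by (cases "h u"; cases "h x") auto
  assume z: "h z < \<infinity>"
  have fin: "h x = ereal (real_of_ereal (h x))" if "h x < \<infinity>" for x
    using that h by (auto simp: ereal_real proper_closed_convex_def)
  note conv = proper_closed_convex_domain[OF h]
  have "((\<lambda>x. - g x) has_derivative (\<lambda>d. - g' d)) (at u)"
    using g by (rule has_derivative_minus)
  then have "- g' (z - u) \<le> real_of_ereal (h z) - real_of_ereal (h u)"
  proof (rule directional_derivative_le)
    fix t :: real assume t: "0 < t" "t \<le> 1"
    define w where "w = (1 - t) *\<^sub>R u + t *\<^sub>R z"
    have "h w < \<infinity>"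
      using convex_on_imp_convex[OF conv] u z t unfolding w_def convex_alt by force
    moreover have "real_of_ereal (h w) \<le> (1 - t) * real_of_ereal (h u) + t * real_of_ereal (h z)"
      unfolding w_def using u z t by (intro convex_onD[OF conv]) auto
    moreover have "ereal (real_of_ereal (h u) + g u) \<le> ereal (real_of_ereal (h w) + g w)"
      using le[of w] fin[OF u] fin[OF \<open>h w < \<infinity>\<close>] by (metis plus_ereal.simps(1))
    moreover have "w = u + t *\<^sub>R (z - u)" by (simp add: w_def algebra_simps)
    ultimately show "- g (u + t *\<^sub>R (z - u)) - - g u \<le> t * (real_of_ereal (h z) - real_of_ereal (h u))"
      by (simp add: algebra_simps)
  qed
  then show "real_of_ereal (h u) - g' (z - u) \<le> real_of_ereal (h z)" by simp
qed

text \<open>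
  Optimality of the proximal point, combined with the three-point identity for Bregman distances.
\<close>

lemma prox_three_point:
  assumes h: "proper_closed_convex h"
    and psi: "\<And>x. psi differentiable (at x)"
    and min: "is_arg_min (prox_objective h psi G eta x) (\<lambda>_. True) u"
  shows "h u < \<infinity>"
    and "h z < \<infinity> \<Longrightarrow> real_of_ereal (h u) + blinfun_apply G (u - z)
          + (1 / eta) * (bregman psi u x + bregman psi z u - bregman psi z x) \<le> real_of_ereal (h z)"
proof -
  define g where "g = (\<lambda>v. blinfun_apply G v + (1 / eta) * bregman psi v x)"
  have min': "is_arg_min (\<lambda>v. h v + ereal (g v)) (\<lambda>_. True) u"
    using min by (simp add: g_def prox_objective_def[abs_def])
  have deriv: "(g has_derivative (\<lambda>d. blinfun_apply G d
      + (1 / eta) * blinfun_apply (grad psi u - grad psi x) d)) (at u)"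
    unfolding g_def bregman_def
    by (rule derivative_eq_intros grad_has_derivative[OF psi] refl
          bounded_linear.has_derivative[OF blinfun.bounded_linear_right] | simp add: blinfun.diff_left)+
  show "h u < \<infinity>" using composite_minimizer_condition(1)[OF h min' deriv] .
  assume "h z < \<infinity>"
  note composite_minimizer_condition(2)[OF h min' deriv this, unfolded bregman_three_point]
  then show "real_of_ereal (h u) + blinfun_apply G (u - z)
          + (1 / eta) * (bregman psi u x + bregman psi z u - bregman psi z x) \<le> real_of_ereal (h z)"
    by (simp add: blinfun.diff_right algebra_simps add_divide_distrib diff_divide_distrib)
qed

section \<open>Averaging over uniform batches\<close>

definition batches :: "nat \<Rightarrow> nat \<Rightarrow> nat set set" where
  "batches n b = {S. S \<subseteq> {1..n} \<and> card S = b}"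

definition batch_avg :: "nat \<Rightarrow> nat \<Rightarrow> (nat set \<Rightarrow> 'v::real_vector) \<Rightarrow> 'v" where
  "batch_avg n b g = (1 / real (n choose b)) *\<^sub>R (\<Sum>S\<in>batches n b. g S)"

lemma finite_batches: "finite (batches n b)"
  unfolding batches_def by (rule finite_subset[of _ "Pow {1..n}"]) auto

lemma card_batches: "card (batches n b) = n choose b"
  unfolding batches_def using n_subsets[of "{1..n}" b] by simp

lemma card_batches_containing:
  assumes "i \<in> {1..n}" "1 \<le> b"
  shows "card {S \<in> batches n b. i \<in> S} = (n - 1) choose (b - 1)"
proof -
  have "bij_betw (insert i) {T. T \<subseteq> {1..n} - {i} \<and> card T = b - 1} {S \<in> batches n b. i \<in> S}"
  proof (rule bij_betwI[where g = "\<lambda>S. S - {i}"])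
    show "insert i \<in> {T. T \<subseteq> {1..n} - {i} \<and> card T = b - 1} \<rightarrow> {S \<in> batches n b. i \<in> S}"
    proof
      fix T assume "T \<in> {T. T \<subseteq> {1..n} - {i} \<and> card T = b - 1}"
      then have T: "T \<subseteq> {1..n} - {i}" "card T = b - 1" by auto
      then have "finite T" "i \<notin> T" using finite_subset[of T "{1..n} - {i}"] by auto
      with T assms show "insert i T \<in> {S \<in> batches n b. i \<in> S}" by (auto simp: batches_def)
    qed
    show "(\<lambda>S. S - {i}) \<in> {S \<in> batches n b. i \<in> S} \<rightarrow> {T. T \<subseteq> {1..n} - {i} \<and> card T = b - 1}"
      by (auto simp: batches_def)
  qed (auto simp: batches_def)
  then have "card {S \<in> batches n b. i \<in> S} = card {T. T \<subseteq> {1..n} - {i} \<and> card T = b - 1}"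
    by (rule bij_betw_same_card[symmetric])
  also have "\<dots> = (n - 1) choose (b - 1)"
    using assms by (subst n_subsets) auto
  finally show ?thesis .
qed

text \<open>
  Each index lies in the same fraction \<open>b / n\<close> of the batches. Unbiasedness of the gradient
  estimator and the expected change of the table both follow from this identity.
\<close>

lemma batch_avg_sum:
  assumes "1 \<le> b" "b \<le> n"
  shows "batch_avg n b (\<lambda>S. \<Sum>i\<in>S. w i) = (real b / real n) *\<^sub>R (\<Sum>i=1..n. w i)"
proof -
  have "(\<Sum>S\<in>batches n b. \<Sum>i\<in>S. w i) = (\<Sum>S\<in>batches n b. \<Sum>i | i \<in> {1..n} \<and> i \<in> S. w i)"
    by (intro sum.cong refl) (auto simp: batches_def)
  also have "\<dots> = (\<Sum>i=1..n. \<Sum>S | S \<in> batches n b \<and> i \<in> S. w i)"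
    by (rule sum.swap_restrict) (auto simp: finite_batches)
  also have "\<dots> = (\<Sum>i=1..n. real ((n - 1) choose (b - 1)) *\<^sub>R w i)"
    using assms by (intro sum.cong refl) (simp add: sum_constant_scaleR card_batches_containing)
  also have "\<dots> = real ((n - 1) choose (b - 1)) *\<^sub>R (\<Sum>i=1..n. w i)"
    by (rule scaleR_sum_right[symmetric])
  finally have "batch_avg n b (\<lambda>S. \<Sum>i\<in>S. w i)
      = (real ((n - 1) choose (b - 1)) / real (n choose b)) *\<^sub>R (\<Sum>i=1..n. w i)"
    by (simp add: batch_avg_def)
  moreover have "real n * real ((n - 1) choose (b - 1)) = real b * real (n choose b)"
    using times_binomial_minus1_eq[of b n] assms by (metis of_nat_mult less_eq_Suc_le One_nat_def)
  then have "real ((n - 1) choose (b - 1)) / real (n choose b) = real b / real n"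
    using assms by (simp add: field_simps)
  ultimately show ?thesis by simp
qed

lemma batch_avg_const:
  assumes "b \<le> n"
  shows "batch_avg n b (\<lambda>S. c) = c"
  using assms by (simp add: batch_avg_def sum_constant_scaleR card_batches)

lemma batch_avg_add: "batch_avg n b (\<lambda>S. g S + g' S) = batch_avg n b g + batch_avg n b g'"
  by (simp add: batch_avg_def sum.distrib scaleR_add_right)

lemma batch_avg_linear:
  assumes "linear T"
  shows "batch_avg n b (\<lambda>S. T (g S)) = T (batch_avg n b g)"
  by (simp add: batch_avg_def linear_scale[OF assms] linear_sum[OF assms])

lemma norm_diff_square_le: "(norm (u - v))\<^sup>2 \<le> 2 * (norm u)\<^sup>2 + 2 * (norm v)\<^sup>2"
  for u v :: "'v::real_normed_vector"
proof -
  have "(norm (u - v))\<^sup>2 \<le> (norm u + norm v)\<^sup>2"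
    by (intro power_mono norm_triangle_ineq4) simp
  also have "\<dots> \<le> 2 * (norm u)\<^sup>2 + 2 * (norm v)\<^sup>2"
    using zero_le_power2[of "norm u - norm v"] by (simp add: power2_eq_square algebra_simps)
  finally show ?thesis .
qed

text \<open>
  In an inner product space the constant would be \<open>1\<close>. A general norm has no such identity, and the
  triangle inequality costs the factor \<open>4\<close>.
\<close>

lemma deviation_from_mean:
  fixes v :: "nat \<Rightarrow> 'v::real_normed_vector"
  shows "(\<Sum>i=1..n. (norm (v i - (1 / real n) *\<^sub>R (\<Sum>j=1..n. v j)))\<^sup>2) \<le> 4 * (\<Sum>i=1..n. (norm (v i))\<^sup>2)"
proof -
  define w where "w = (1 / real n) *\<^sub>R (\<Sum>j=1..n. v j)"
  have "norm w \<le> (1 / real n) * (\<Sum>i=1..n. norm (v i))"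
    by (simp add: w_def divide_right_mono norm_sum)
  then have "(norm w)\<^sup>2 \<le> (1 / real n)\<^sup>2 * (\<Sum>i=1..n. norm (v i))\<^sup>2"
    by (metis norm_ge_zero power_mono power_mult_distrib)
  also have "\<dots> \<le> (1 / real n)\<^sup>2 * (real n * (\<Sum>i=1..n. (norm (v i))\<^sup>2))"
    using sum_squared_le_sum_of_squares[of "\<lambda>i. norm (v i)" "{1..n}"]
    by (intro mult_left_mono) (auto simp: mult.commute)
  finally have w: "real n * (norm w)\<^sup>2 \<le> (\<Sum>i=1..n. (norm (v i))\<^sup>2)"
    by (cases "n = 0") (simp_all add: power2_eq_square field_simps)
  have "(\<Sum>i=1..n. (norm (v i - w))\<^sup>2) \<le> (\<Sum>i=1..n. 2 * (norm (v i))\<^sup>2 + 2 * (norm w)\<^sup>2)"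
    by (intro sum_mono norm_diff_square_le)
  also have "\<dots> \<le> 4 * (\<Sum>i=1..n. (norm (v i))\<^sup>2)"
    using w by (simp add: sum.distrib sum_distrib_left[symmetric])
  finally show ?thesis by (simp add: w_def)
qed

section \<open>One proximal step\<close>

text \<open>
  The deterministic data of the problem. The bound on the sampling variance is stated as an average
  over all batches, so that this part of the argument involves no probability space.
\<close>

locale composite_problem =
  fixes n b :: nat
    and fs :: "nat \<Rightarrow> 'a::real_normed_vector \<Rightarrow> real"
    and h :: "'a \<Rightarrow> ereal"
    and psi :: "'a \<Rightarrow> real"
    and D :: "'a set"
    and xstar :: 'a
    and eta_min eta_max sigma_b Lbar M mu :: real
  assumes b: "1 \<le> b" "b \<le> n"
    and fs_diff: "\<And>i x. i \<in> {1..n} \<Longrightarrow> x \<in> D \<Longrightarrow> fs i differentiable (at x)"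
    and eta_min: "0 < eta_min"
    and psi_diff: "\<And>x. psi differentiable (at x)"
    and psi_sc: "\<And>x y. bregman psi x y \<ge> 1 / 2 * (norm (x - y))\<^sup>2"
    and h: "proper_closed_convex h"
    and prox_unique: "\<And>x G e. x \<in> D \<Longrightarrow> e \<in> {eta_min..eta_max} \<Longrightarrow>
          \<exists>!u. is_arg_min (prox_objective h psi G e x) (\<lambda>_. True) u"
    and D_convex: "convex D"
    and xstar: "is_arg_min (composite n fs h) (\<lambda>_. True) xstar" "xstar \<in> D"
    and sigma_b: "sigma_b \<ge> 1"
    and batch_variance: "\<And>v :: nat \<Rightarrow> 'a \<Rightarrow>\<^sub>L real.
          batch_avg n b (\<lambda>S. (norm ((1 / real b) *\<^sub>R
            (\<Sum>i\<in>S. v i - (1 / real n) *\<^sub>R (\<Sum>j=1..n. v j))))\<^sup>2)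
          \<le> sigma_b / (real b * real n)
              * (\<Sum>i=1..n. (norm (v i - (1 / real n) *\<^sub>R (\<Sum>j=1..n. v j)))\<^sup>2)"
    and Lbar: "Lbar > 0"
    and rel_smooth: "\<And>x y. x \<in> D \<Longrightarrow> y \<in> D \<Longrightarrow>
          bregman (avg_fun n fs) x y \<le> Lbar * bregman psi x y"
    and M: "M \<ge> 0"
    and fs_lip: "\<And>i x y. i \<in> {1..n} \<Longrightarrow> x \<in> D \<Longrightarrow> y \<in> D \<Longrightarrow>
          norm (grad (fs i) x - grad (fs i) y) \<le> M * norm (x - y)"
    and fs_convex: "\<And>i. i \<in> {1..n} \<Longrightarrow> convex_on D (fs i)"
    and fs_cocoercive: "\<And>i x y. i \<in> {1..n} \<Longrightarrow> x \<in> D \<Longrightarrow> y \<in> D \<Longrightarrow>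
          (norm (grad (fs i) x - grad (fs i) y))\<^sup>2 \<le> 2 * M * bregman (fs i) x y"
    and eta_max_le: "eta_max \<le> 1 / (Lbar + 32 * sigma_b * M / real b)"
    and mu: "mu > 0"
    and growth: "\<And>x. x \<in> D \<Longrightarrow>
          composite n fs h x - composite n fs h xstar \<ge> ereal (mu * bregman psi xstar x)"
begin

abbreviation f :: "'a \<Rightarrow> real" where "f \<equiv> avg_fun n fs"

abbreviation hr :: "'a \<Rightarrow> real" where "hr x \<equiv> real_of_ereal (h x)"

definition gap :: "'a \<Rightarrow> real" where
  "gap x = f x + hr x - (f xstar + hr xstar)"

text \<open>
  The Lyapunov quantity of the gradient table: it controls the error caused by outdated entries.
\<close>

definition table_gap :: "(nat \<Rightarrow> 'a) \<Rightarrow> real" where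
  "table_gap phi = (1 / real n) * (\<Sum>i=1..n. bregman (fs i) (phi i) xstar)"

definition grad_shift :: "'a \<Rightarrow> (nat \<Rightarrow> 'a) \<Rightarrow> nat \<Rightarrow> 'a \<Rightarrow>\<^sub>L real" where
  "grad_shift x phi i = grad (fs i) x - grad (fs i) (phi i)"

definition noise :: "nat set \<Rightarrow> 'a \<Rightarrow> (nat \<Rightarrow> 'a) \<Rightarrow> 'a \<Rightarrow>\<^sub>L real" where
  "noise S x phi = (1 / real b) *\<^sub>R
     (\<Sum>i\<in>S. grad_shift x phi i - (1 / real n) *\<^sub>R (\<Sum>j=1..n. grad_shift x phi j))"

lemma n_pos: "0 < n" using b by simp

lemma h_real: "h x < \<infinity> \<Longrightarrow> h x = ereal (hr x)"
  using h by (auto simp: ereal_real proper_closed_convex_def)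

lemma psi_nonneg: "0 \<le> bregman psi x y"
  by (rule order_trans[OF _ psi_sc]) simp

lemma f_has_derivative:
  assumes "x \<in> D"
  shows "(f has_derivative blinfun_apply ((1 / real n) *\<^sub>R (\<Sum>i=1..n. grad (fs i) x))) (at x)"
proof -
  have "((\<lambda>x. (1 / real n) * (\<Sum>i=1..n. fs i x)) has_derivative
      (\<lambda>d. (1 / real n) * (\<Sum>i=1..n. blinfun_apply (grad (fs i) x) d))) (at x)"
    using assms fs_diff by (intro has_derivative_mult_right has_derivative_sum grad_has_derivative) auto
  moreover have "(\<lambda>d. (1 / real n) * (\<Sum>i=1..n. blinfun_apply (grad (fs i) x) d))
      = blinfun_apply ((1 / real n) *\<^sub>R (\<Sum>i=1..n. grad (fs i) x))"
    by (auto simp: fun_eq_iff blinfun.scaleR_left blinfun.sum_left)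
  ultimately show ?thesis by (simp add: avg_fun_def[abs_def])
qed

lemma grad_f: "x \<in> D \<Longrightarrow> grad f x = (1 / real n) *\<^sub>R (\<Sum>i=1..n. grad (fs i) x)"
  by (rule grad_eqI[OF f_has_derivative])

lemma bregman_f:
  assumes "y \<in> D"
  shows "bregman f x y = (1 / real n) * (\<Sum>i=1..n. bregman (fs i) x y)"
  by (simp add: bregman_def grad_f[OF assms] avg_fun_def blinfun.scaleR_left blinfun.sum_left
      sum_subtractf right_diff_distrib diff_divide_distrib)

lemma fs_bregman_nonneg: "i \<in> {1..n} \<Longrightarrow> x \<in> D \<Longrightarrow> y \<in> D \<Longrightarrow> 0 \<le> bregman (fs i) x y"
  by (rule convex_on_bregman_nonneg[OF fs_convex fs_diff])

lemma f_bregman_nonneg: "x \<in> D \<Longrightarrow> y \<in> D \<Longrightarrow> 0 \<le> bregman f x y"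
  unfolding bregman_f by (intro mult_nonneg_nonneg sum_nonneg fs_bregman_nonneg) auto

lemma table_gap_nonneg: "(\<And>i. i \<in> {1..n} \<Longrightarrow> phi i \<in> D) \<Longrightarrow> 0 \<le> table_gap phi"
  unfolding table_gap_def by (intro mult_nonneg_nonneg sum_nonneg fs_bregman_nonneg xstar(2)) auto

lemma table_gap_const: "table_gap (\<lambda>i. x) = bregman f x xstar"
  by (simp add: table_gap_def bregman_f xstar)

lemma composite_eq: "composite n fs h = (\<lambda>x. h x + ereal (f x))"
  by (simp add: composite_def fun_eq_iff add.commute)

lemma h_xstar: "h xstar < \<infinity>"
  by (rule composite_minimizer_condition(1)[OF h xstar(1)[unfolded composite_eq] f_has_derivative[OF xstar(2)]])

lemma xstar_optimal: "h z < \<infinity> \<Longrightarrow> hr xstar - blinfun_apply (grad f xstar) (z - xstar) \<le> hr z"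
  unfolding grad_f[OF xstar(2)]
  by (rule composite_minimizer_condition(2)[OF h xstar(1)[unfolded composite_eq] f_has_derivative[OF xstar(2)]])

lemma composite_real:
  assumes "h x < \<infinity>"
  shows "composite n fs h x = ereal (f x + hr x)"
  unfolding composite_def by (subst h_real[OF assms]) simp

lemma composite_gap:
  assumes "h x < \<infinity>"
  shows "composite n fs h x - composite n fs h xstar = ereal (gap x)"
  by (simp only: composite_real[OF assms] composite_real[OF h_xstar] gap_def ereal_minus)

text \<open>
  Optimality of \<open>xstar\<close> makes \<open>h x - h xstar\<close> at least \<open>- \<langle>\<nabla>f xstar, x - xstar\<rangle>\<close>.
\<close>

lemma bregman_le_gap: "h x < \<infinity> \<Longrightarrow> bregman f x xstar \<le> gap x"
  using xstar_optimal[of x] by (simp add: bregman_def gap_def)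

lemma growth_gap: "x \<in> D \<Longrightarrow> h x < \<infinity> \<Longrightarrow> mu * bregman psi xstar x \<le> gap x"
  using growth[of x] by (simp add: composite_gap)

lemma gap_convex: "convex_on {x \<in> D. h x < \<infinity>} gap"
proof -
  have conv: "convex {x \<in> D. h x < \<infinity>}"
    using convex_Int[OF D_convex convex_on_imp_convex[OF proper_closed_convex_domain[OF h]]]
    by (simp only: Int_def mem_Collect_eq)
  have sums: "convex_on {x \<in> D. h x < \<infinity>} (\<lambda>x. \<Sum>i\<in>I. fs i x)" if "finite I" "I \<subseteq> {1..n}" for I
    using that
  proof (induction I rule: finite_induct)
    case (insert i I)
    have "convex_on {x \<in> D. h x < \<infinity>} (fs i)"
      using insert by (intro convex_on_subset[OF fs_convex _ conv]) auto
    with insert show ?case by (simp add: convex_on_add)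
  qed (simp only: sum.empty convex_on_const conv)
  have "convex_on {x \<in> D. h x < \<infinity>} f"
    unfolding avg_fun_def[abs_def] by (intro convex_on_cmul sums) auto
  moreover have "convex_on {x \<in> D. h x < \<infinity>} hr"
    by (rule convex_on_subset[OF proper_closed_convex_domain[OF h] _ conv]) auto
  ultimately have "convex_on {x \<in> D. h x < \<infinity>} (\<lambda>x. f x + hr x + - (f xstar + hr xstar))"
    by (intro convex_on_add) (simp_all only: convex_on_const conv)
  moreover have "gap = (\<lambda>x. f x + hr x + - (f xstar + hr xstar))"
    by (simp add: gap_def fun_eq_iff)
  ultimately show ?thesis by (simp only:)
qed

text \<open>
  The estimator of the algorithm splits into the true gradient and the noise: the mean of the
  shifts is the difference between the gradient at \<open>x\<close> and the mean of the stored gradients.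
\<close>

lemma estimator_eq:
  assumes "S \<in> batches n b" "x \<in> D"
  shows "(1 / real b) *\<^sub>R (\<Sum>i\<in>S. grad_shift x phi i) + (1 / real n) *\<^sub>R (\<Sum>i=1..n. grad (fs i) (phi i))
      = grad f x + noise S x phi"
proof -
  have "card S = b" using assms by (simp add: batches_def)
  then have "noise S x phi = (1 / real b) *\<^sub>R (\<Sum>i\<in>S. grad_shift x phi i)
      - (1 / real n) *\<^sub>R (\<Sum>j=1..n. grad_shift x phi j)"
    using b by (simp add: noise_def sum_subtractf sum_constant_scaleR scaleR_diff_right)
  then show ?thesis
    by (simp add: grad_f[OF assms(2)] grad_shift_def sum_subtractf scaleR_diff_right)
qed

lemma noise_unbiased: "batch_avg n b (\<lambda>S. blinfun_apply (noise S x phi) d) = 0"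
proof -
  have "batch_avg n b (\<lambda>S. noise S x phi) = (1 / real b) *\<^sub>R batch_avg n b (\<lambda>S.
      \<Sum>i\<in>S. grad_shift x phi i - (1 / real n) *\<^sub>R (\<Sum>j=1..n. grad_shift x phi j))"
    unfolding noise_def by (rule batch_avg_linear) (rule linear_scaleR)
  also have "\<dots> = 0"
    unfolding batch_avg_sum[OF b] using n_pos by (simp add: sum_subtractf sum_constant_scaleR)
  finally have "batch_avg n b (\<lambda>S. noise S x phi) = 0" .
  moreover have "linear (\<lambda>e. blinfun_apply e d)"
    by (rule bounded_linear.linear[OF blinfun.bounded_linear_left])
  from batch_avg_linear[OF this, of n b "\<lambda>S. noise S x phi"]
  have "batch_avg n b (\<lambda>S. blinfun_apply (noise S x phi) d) = blinfun_apply (batch_avg n b (\<lambda>S. noise S x phi)) d" .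
  ultimately show ?thesis by simp
qed

lemma table_gap_update:
  "batch_avg n b (\<lambda>S. table_gap (\<lambda>i. if i \<in> S then x else phi i))
     = (1 - real b / real n) * table_gap phi + real b / real n * bregman f x xstar"
proof -
  define d where "d i = bregman (fs i) x xstar - bregman (fs i) (phi i) xstar" for i
  have "batch_avg n b (\<lambda>S. table_gap (\<lambda>i. if i \<in> S then x else phi i))
      = batch_avg n b (\<lambda>S. table_gap phi + (1 / real n) *\<^sub>R (\<Sum>i\<in>S. d i))"
    unfolding batch_avg_def
  proof (intro arg_cong[where f = "\<lambda>u. _ *\<^sub>R u"] sum.cong refl)
    fix S assume "S \<in> batches n b"
    then have S: "S \<subseteq> {1..n}" by (simp add: batches_def)
    have "(\<Sum>i=1..n. bregman (fs i) (if i \<in> S then x else phi i) xstar)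
        = (\<Sum>i=1..n. bregman (fs i) (phi i) xstar + (if i \<in> S then d i else 0))"
      by (rule sum.cong) (auto simp: d_def)
    also have "\<dots> = (\<Sum>i=1..n. bregman (fs i) (phi i) xstar) + (\<Sum>i\<in>S. d i)"
      using S by (simp add: sum.distrib sum.If_cases Int_absorb1)
    finally show "table_gap (\<lambda>i. if i \<in> S then x else phi i)
        = table_gap phi + (1 / real n) *\<^sub>R (\<Sum>i\<in>S. d i)"
      by (simp add: table_gap_def add_divide_distrib)
  qed
  also have "\<dots> = table_gap phi + (1 / real n) * (real b / real n * (\<Sum>i=1..n. d i))"
    using b by (simp add: batch_avg_add batch_avg_const batch_avg_linear[OF linear_scaleR] batch_avg_sum
        flip: real_scaleR_def)
  also have "\<dots> = (1 - real b / real n) * table_gap phi + real b / real n * bregman f x xstar"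
    using n_pos by (simp add: d_def sum_subtractf table_gap_def bregman_f xstar field_simps)
  finally show ?thesis .
qed

text \<open>
  Young's inequality is applied with the parameter \<open>c = 32 sigma_b M / b\<close> left over by the bound on
  the step sizes, and this is \<open>1 / (2 c)\<close>. For \<open>M = 0\<close> it is \<open>0\<close> by division by zero; the noise
  vanishes in that case.
\<close>

definition noise_weight :: real where
  "noise_weight = real b / (64 * sigma_b * M)"

text \<open>
  Passing from the deviation from the mean to the shifts themselves costs a factor \<open>4\<close>. Inserting
  the gradient at \<open>xstar\<close> and cocoercivity bound a squared shift by \<open>4 M\<close> times two Bregman
  distances to \<open>xstar\<close>. Together this is \<open>16 sigma_b M / b\<close>, a quarter of the inverse weight.
\<close>

lemma noise_second_moment:
  assumes x: "x \<in> D" and phi: "\<And>i. i \<in> {1..n} \<Longrightarrow> phi i \<in> D"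
  shows "noise_weight * batch_avg n b (\<lambda>S. (norm (noise S x phi))\<^sup>2)
     \<le> 1 / 4 * (bregman f x xstar + table_gap phi)"
proof (cases "M = 0")
  case True
  then have "noise_weight = 0" unfolding noise_weight_def by simp
  then show ?thesis
    using f_bregman_nonneg[OF x xstar(2)] table_gap_nonneg[OF phi] by simp
next
  case False
  with M have "M > 0" by simp
  have "(norm (grad_shift x phi i))\<^sup>2 \<le> 4 * M * (bregman (fs i) x xstar + bregman (fs i) (phi i) xstar)"
    if i: "i \<in> {1..n}" for i
  proof -
    have "(norm (grad_shift x phi i))\<^sup>2
        \<le> 2 * (norm (grad (fs i) x - grad (fs i) xstar))\<^sup>2 + 2 * (norm (grad (fs i) (phi i) - grad (fs i) xstar))\<^sup>2"
      using norm_diff_square_le[of "grad (fs i) x - grad (fs i) xstar" "grad (fs i) (phi i) - grad (fs i) xstar"]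
      by (simp add: grad_shift_def)
    then show ?thesis
      using fs_cocoercive[OF i x xstar(2)] fs_cocoercive[OF i phi[OF i] xstar(2)] by (simp add: algebra_simps)
  qed
  then have "(\<Sum>i=1..n. (norm (grad_shift x phi i))\<^sup>2)
      \<le> (\<Sum>i=1..n. 4 * M * (bregman (fs i) x xstar + bregman (fs i) (phi i) xstar))"
    by (rule sum_mono)
  also have "\<dots> = 4 * M * (real n * (bregman f x xstar + table_gap phi))"
    using n_pos by (simp add: bregman_f[OF xstar(2)] table_gap_def sum_distrib_left[symmetric] sum.distrib algebra_simps)
  finally have sq: "(\<Sum>i=1..n. (norm (grad_shift x phi i))\<^sup>2) \<le> 4 * M * (real n * (bregman f x xstar + table_gap phi))" .
  have "batch_avg n b (\<lambda>S. (norm (noise S x phi))\<^sup>2) \<le> sigma_b / (real b * real n) *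
      (\<Sum>i=1..n. (norm (grad_shift x phi i - (1 / real n) *\<^sub>R (\<Sum>j=1..n. grad_shift x phi j)))\<^sup>2)"
    unfolding noise_def by (rule batch_variance)
  also have "\<dots> \<le> sigma_b / (real b * real n) * (4 * (4 * M * (real n * (bregman f x xstar + table_gap phi))))"
    using sigma_b sq deviation_from_mean[of "grad_shift x phi" n] by (intro mult_left_mono) auto
  finally have "noise_weight * batch_avg n b (\<lambda>S. (norm (noise S x phi))\<^sup>2)
      \<le> noise_weight * (sigma_b / (real b * real n) * (4 * (4 * M * (real n * (bregman f x xstar + table_gap phi)))))"
    using sigma_b M by (intro mult_left_mono) (auto simp: noise_weight_def)
  also have "\<dots> = 1 / 4 * (bregman f x xstar + table_gap phi)"
    using sigma_b \<open>M > 0\<close> b n_pos by (simp add: noise_weight_def field_simps)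
  finally show ?thesis .
qed

lemma noise_eq_0:
  assumes "M = 0" "S \<in> batches n b" "x \<in> D" "\<And>i. i \<in> {1..n} \<Longrightarrow> phi i \<in> D"
  shows "noise S x phi = 0"
proof -
  have "grad_shift x phi i = 0" if "i \<in> {1..n}" for i
    using fs_lip[of i x "phi i"] that assms by (simp add: grad_shift_def)
  moreover have "S \<subseteq> {1..n}" using assms by (simp add: batches_def)
  ultimately show ?thesis by (auto simp: noise_def intro!: sum.neutral)
qed

text \<open>
  The proximal inequality at \<open>xstar\<close> is added to the smoothness bound between \<open>u\<close> and \<open>x\<close> and the
  convexity bound between \<open>xstar\<close> and \<open>x\<close>; the gradients of \<open>f\<close> cancel and leave the noise paired
  with \<open>xstar - u\<close>. The part in \<open>xstar - x\<close> is kept, since it has mean zero. The part in \<open>x - u\<close>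
  is split by Young's inequality, and its quadratic half is absorbed by \<open>1 / e \<ge> Lbar + c\<close> and
  strong convexity of \<open>psi\<close>.
\<close>

lemma prox_step_progress:
  assumes S: "S \<in> batches n b" and x: "x \<in> D" and phi: "\<And>i. i \<in> {1..n} \<Longrightarrow> phi i \<in> D"
    and e: "eta_min \<le> e" "e \<le> eta_max"
    and G: "G = (1 / real b) *\<^sub>R (\<Sum>i\<in>S. grad_shift x phi i) + (1 / real n) *\<^sub>R (\<Sum>i=1..n. grad (fs i) (phi i))"
    and u: "u = arg_min (prox_objective h psi G e x) (\<lambda>_. True)" "u \<in> D"
  shows "h u < \<infinity>"
    and "gap u \<le> blinfun_apply (noise S x phi) (xstar - x) + noise_weight * (norm (noise S x phi))\<^sup>2
           + (1 / e) * (bregman psi xstar x - bregman psi xstar u)"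
proof -
  let ?N = "noise S x phi"
  have "\<exists>v. is_arg_min (prox_objective h psi G e x) (\<lambda>_. True) v"
    using prox_unique[of x e G] x e by auto
  then have "is_arg_min (prox_objective h psi G e x) (\<lambda>_. True) u"
    unfolding u(1) arg_min_def by (rule someI_ex)
  note prox = prox_three_point[OF h psi_diff this]
  show u_dom: "h u < \<infinity>" by (rule prox(1))
  have G': "G = grad f x + ?N" unfolding G by (rule estimator_eq[OF S x])
  define c where "c = 32 * sigma_b * M / real b"
  have "0 \<le> c" using sigma_b M by (simp add: c_def)
  have "e \<le> 1 / (Lbar + c)" using order_trans[OF e(2) eta_max_le] unfolding c_def .
  moreover have "0 < e" "0 < Lbar + c" using eta_min e Lbar \<open>0 \<le> c\<close> by auto
  ultimately have "Lbar + c \<le> 1 / e" by (simp add: pos_le_divide_eq mult.commute)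
  then have "(Lbar + c) * bregman psi u x \<le> (1 / e) * bregman psi u x"
    by (intro mult_right_mono psi_nonneg)
  then have quad: "Lbar * bregman psi u x + c / 2 * (norm (u - x))\<^sup>2 \<le> (1 / e) * bregman psi u x"
    using mult_left_mono[OF psi_sc[of u x] \<open>0 \<le> c\<close>] unfolding distrib_right by simp
  have young: "- blinfun_apply ?N (u - x) \<le> noise_weight * (norm ?N)\<^sup>2 + c / 2 * (norm (u - x))\<^sup>2"
  proof (cases "M = 0")
    case True
    then have "?N = 0" by (intro noise_eq_0 S x phi)
    then show ?thesis using \<open>0 \<le> c\<close> by simp
  next
    case False
    then have "0 < c" using sigma_b M b by (simp add: c_def)
    have "noise_weight = 1 / (2 * c)" by (simp add: noise_weight_def c_def)
    moreover have "norm ?N * norm (u - x) \<le> 1 / (2 * c) * (norm ?N)\<^sup>2 + c / 2 * (norm (u - x))\<^sup>2"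
    proof -
      have "0 \<le> (norm ?N - c * norm (u - x))\<^sup>2 / (2 * c)" using \<open>0 < c\<close> by simp
      also have "\<dots> = 1 / (2 * c) * (norm ?N)\<^sup>2 + c / 2 * (norm (u - x))\<^sup>2 - norm ?N * norm (u - x)"
        using \<open>0 < c\<close> by (simp add: power2_eq_square field_simps)
      finally show ?thesis by simp
    qed
    moreover have "- blinfun_apply ?N (u - x) \<le> norm ?N * norm (u - x)"
      using norm_blinfun[of ?N "u - x"] by simp
    ultimately show ?thesis by simp
  qed
  have "bregman f u x \<le> Lbar * bregman psi u x" "0 \<le> bregman f xstar x"
    using rel_smooth[OF u(2) x] f_bregman_nonneg[OF xstar(2) x] by auto
  moreover have "blinfun_apply G (u - xstar)
      = blinfun_apply (grad f x) (u - x) - blinfun_apply (grad f x) (xstar - x)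
        + blinfun_apply ?N (u - x) - blinfun_apply ?N (xstar - x)"
    by (simp add: G' blinfun.add_left blinfun.diff_right)
  moreover note prox(2)[OF h_xstar]
  ultimately show "gap u \<le> blinfun_apply (noise S x phi) (xstar - x)
      + noise_weight * (norm (noise S x phi))\<^sup>2 + (1 / e) * (bregman psi xstar x - bregman psi xstar u)"
    using quad young unfolding gap_def bregman_def[of f] right_diff_distrib distrib_left by linarith
qed

end

section \<open>Functions of the batches drawn so far\<close>

text \<open>
  Points that no generator separates are not separated by the generated sigma-algebra. Hence a
  measurable real function is determined by the batches that generate the history.
\<close>

lemma sigma_sets_not_separating:
  assumes "A \<in> sigma_sets Om G" "\<omega> \<in> Om" "\<omega>' \<in> Om" "\<And>C. C \<in> G \<Longrightarrow> \<omega> \<in> C \<longleftrightarrow> \<omega>' \<in> C"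
  shows "\<omega> \<in> A \<longleftrightarrow> \<omega>' \<in> A"
  using assms(1) by induction (use assms(2-4) in auto)

locale batch_process = prob_space P
  for P :: "'w measure" +
  fixes n b K :: nat
    and B :: "nat \<Rightarrow> nat \<Rightarrow> 'w \<Rightarrow> nat set"
  assumes b_le: "b \<le> n"
    and B_rv: "\<And>t k. k < K \<Longrightarrow> B t k \<in> measurable P (count_space (batches n b))"
    and B_unif: "\<And>t k S. k < K \<Longrightarrow> S \<in> batches n b \<Longrightarrow>
          AE \<omega> in P. real_cond_exp P (batch_history P K B t k)
                       (indicat_real {\<omega> \<in> space P. B t k \<omega> = S}) \<omega> = 1 / real (n choose b)"
begin

abbreviation hist :: "nat \<Rightarrow> nat \<Rightarrow> 'w measure" where
  "hist \<equiv> batch_history P K B"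

text \<open>
  \<open>Y\<close> is determined by the batches drawn before iteration \<open>k\<close> of round \<open>t\<close>. In contrast to
  measurability, this is preserved by arbitrary operations and needs no structure on the target
  type; the algorithm's \<open>arg_min\<close>, for instance, causes no difficulty.
\<close>

definition adapted :: "nat \<Rightarrow> nat \<Rightarrow> ('w \<Rightarrow> 'c) \<Rightarrow> bool" where
  "adapted t k Y \<longleftrightarrow> (\<forall>\<omega>\<in>space P. \<forall>\<omega>'\<in>space P.
     (\<forall>s j. (s < t \<and> j < K) \<or> (s = t \<and> j < k) \<longrightarrow> B s j \<omega> = B s j \<omega>') \<longrightarrow> Y \<omega> = Y \<omega>')"

lemma B_in_batches: "k < K \<Longrightarrow> \<omega> \<in> space P \<Longrightarrow> B t k \<omega> \<in> batches n b"
  using measurable_space[OF B_rv] by auto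

lemma B_event: "k < K \<Longrightarrow> {\<omega> \<in> space P. B t k \<omega> = S} \<in> sets P"
proof (cases "S \<in> batches n b")
  case True
  assume "k < K"
  from measurable_sets[OF B_rv[OF this], of "{S}" t] True show ?thesis
    by (simp add: vimage_def Int_def conj_commute)
next
  case False
  assume "k < K"
  then have "{\<omega> \<in> space P. B t k \<omega> = S} = {}" using B_in_batches False by auto
  then show ?thesis by (simp only: sets.empty_sets)
qed

lemma space_hist: "space (hist t k) = space P"
  and sets_hist: "sets (hist t k) = sigma_sets (space P)
        {B s j -` {S} \<inter> space P | s j S. (s < t \<and> j < K) \<or> (s = t \<and> j < k)}"
  unfolding batch_history_def by (subst space_measure_of sets_measure_of, blast, simp)+

lemma hist_subalgebra:
  assumes "k \<le> K"
  shows "subalgebra P (hist t k)"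
proof -
  have "B s j -` {S} \<inter> space P \<in> sets P" if "j < K" for s j S
    using B_event[OF that, of s S] by (simp add: vimage_def Int_def conj_commute)
  then have "sets (hist t k) \<subseteq> sets P"
    unfolding sets_hist using assms by (intro sets.sigma_sets_subset) auto
  then show ?thesis by (simp add: subalgebra_def space_hist)
qed

lemma adapted_of_measurable:
  fixes Y :: "'w \<Rightarrow> real"
  assumes "Y \<in> borel_measurable (hist t k)"
  shows "adapted t k Y"
  unfolding adapted_def
proof (intro ballI impI)
  fix \<omega> \<omega>' assume \<omega>: "\<omega> \<in> space P" "\<omega>' \<in> space P"
    and same: "\<forall>s j. (s < t \<and> j < K) \<or> (s = t \<and> j < k) \<longrightarrow> B s j \<omega> = B s j \<omega>'"
  have "Y -` {Y \<omega>} \<inter> space P \<in> sets (hist t k)"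
    using measurable_sets[OF assms, of "{Y \<omega>}"] by (simp add: space_hist)
  then have "\<omega> \<in> Y -` {Y \<omega>} \<inter> space P \<longleftrightarrow> \<omega>' \<in> Y -` {Y \<omega>} \<inter> space P"
    unfolding sets_hist
  proof (rule sigma_sets_not_separating[OF _ \<omega>])
    fix C assume "C \<in> {B s j -` {S} \<inter> space P | s j S. (s < t \<and> j < K) \<or> (s = t \<and> j < k)}"
    then obtain s j S where C: "C = B s j -` {S} \<inter> space P" "(s < t \<and> j < K) \<or> (s = t \<and> j < k)"
      by blast
    then have "B s j \<omega> = B s j \<omega>'" using same by blast
    with \<omega> show "\<omega> \<in> C \<longleftrightarrow> \<omega>' \<in> C" by (simp add: C(1))
  qed
  with \<omega> show "Y \<omega> = Y \<omega>'" by auto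
qed

lemma adaptedD:
  assumes "adapted t k Y" "\<omega> \<in> space P" "\<omega>' \<in> space P"
    and "\<And>s j. (s < t \<and> j < K) \<or> (s = t \<and> j < k) \<Longrightarrow> B s j \<omega> = B s j \<omega>'"
  shows "Y \<omega> = Y \<omega>'"
  using assms unfolding adapted_def by blast

lemma adapted_comp: "adapted t k Y \<Longrightarrow> adapted t k (\<lambda>\<omega>. g (Y \<omega>))"
  unfolding adapted_def by (intro ballI impI arg_cong[where f = g]) blast

lemma adapted_comp2: "adapted t k Y \<Longrightarrow> adapted t k Z \<Longrightarrow> adapted t k (\<lambda>\<omega>. g (Y \<omega>) (Z \<omega>))"
  unfolding adapted_def by (intro ballI impI arg_cong2[where f = g]) blast+

lemma adapted_const: "adapted t k (\<lambda>\<omega>. c)"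
  by (simp add: adapted_def)

lemma adapted_batch: "adapted t (Suc k) (B t k)"
  by (auto simp: adapted_def)

lemma adapted_weaken:
  assumes Y: "adapted t k Y"
    and later: "\<And>s j. (s < t \<and> j < K) \<or> (s = t \<and> j < k) \<Longrightarrow> (s < t' \<and> j < K) \<or> (s = t' \<and> j < k')"
  shows "adapted t' k' Y"
  unfolding adapted_def
proof (intro ballI impI)
  fix \<omega> \<omega>' assume "\<omega> \<in> space P" "\<omega>' \<in> space P"
    and same: "\<forall>s j. (s < t' \<and> j < K) \<or> (s = t' \<and> j < k') \<longrightarrow> B s j \<omega> = B s j \<omega>'"
  from Y this(1,2) show "Y \<omega> = Y \<omega>'"
    by (rule adaptedD) (rule same[rule_format, OF later])
qed

lemma adapted_mono: "adapted t k Y \<Longrightarrow> k \<le> k' \<Longrightarrow> adapted t k' Y"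
  by (erule adapted_weaken) auto

lemma adapted_next_round: "adapted t K Y \<Longrightarrow> adapted (Suc t) 0 Y"
  by (erule adapted_weaken) auto

lemma adapted_sum:
  assumes "\<And>i. i \<in> A \<Longrightarrow> adapted t k (Y i)"
  shows "adapted t k (\<lambda>\<omega>. \<Sum>i\<in>A. Y i \<omega>)"
  unfolding adapted_def
proof (intro ballI impI sum.cong refl)
  fix \<omega> \<omega>' i
  assume "\<omega> \<in> space P" "\<omega>' \<in> space P" "i \<in> A"
    and same: "\<forall>s j. (s < t \<and> j < K) \<or> (s = t \<and> j < k) \<longrightarrow> B s j \<omega> = B s j \<omega>'"
  from assms[OF this(3)] this(1,2) show "Y i \<omega> = Y i \<omega>'"
    by (rule adaptedD) (rule same[rule_format])
qed

text \<open>
  The batches drawn so far take only finitely many joint values. Each joint value describes an atom,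
  a finite intersection of generators of the history, and \<open>Y\<close> is constant on each atom.
\<close>

lemma adapted_simple_function:
  assumes Y: "adapted t k Y" and k: "k \<le> K"
  shows "simple_function (hist t k) Y"
proof -
  define I where "I = {..<t} \<times> {..<K} \<union> {t} \<times> {..<k}"
  define past where "past \<omega> = (\<lambda>p\<in>I. B (fst p) (snd p) \<omega>)" for \<omega>
  have "finite I" by (simp add: I_def)
  have I_K: "snd p < K" if "p \<in> I" for p using that k by (auto simp: I_def)
  have past_eq: "past \<omega> = past \<omega>' \<longleftrightarrow> (\<forall>p\<in>I. B (fst p) (snd p) \<omega> = B (fst p) (snd p) \<omega>')" for \<omega> \<omega>'
  proof
    assume eq: "past \<omega> = past \<omega>'"
    show "\<forall>p\<in>I. B (fst p) (snd p) \<omega> = B (fst p) (snd p) \<omega>'"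
    proof
      fix p assume "p \<in> I"
      then show "B (fst p) (snd p) \<omega> = B (fst p) (snd p) \<omega>'"
        using fun_cong[OF eq, of p] by (simp add: past_def)
    qed
  qed (simp add: past_def cong: restrict_cong)
  have Y_past: "Y \<omega> = Y \<omega>'" if "\<omega> \<in> space P" "\<omega>' \<in> space P" "past \<omega> = past \<omega>'" for \<omega> \<omega>'
  proof (rule adaptedD[OF Y that(1,2)])
    fix s j assume "(s < t \<and> j < K) \<or> (s = t \<and> j < k)"
    then have "(s, j) \<in> I" by (auto simp: I_def)
    with that(3) show "B s j \<omega> = B s j \<omega>'" unfolding past_eq by fastforce
  qed
  have "past ` space P \<subseteq> PiE I (\<lambda>_. batches n b)"
    by (intro image_subsetI PiE_I) (simp_all add: past_def B_in_batches I_K)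
  then have fin: "finite (past ` space P)"
    by (rule finite_subset) (simp add: \<open>finite I\<close> finite_PiE finite_batches)
  define G where "G c = Y (SOME \<omega>. \<omega> \<in> space P \<and> past \<omega> = c)" for c
  have "Y \<omega> = G (past \<omega>)" if \<omega>: "\<omega> \<in> space P" for \<omega>
  proof -
    have "(SOME \<omega>'. \<omega>' \<in> space P \<and> past \<omega>' = past \<omega>) \<in> space P
        \<and> past (SOME \<omega>'. \<omega>' \<in> space P \<and> past \<omega>' = past \<omega>) = past \<omega>"
      by (rule someI[of "\<lambda>\<omega>'. \<omega>' \<in> space P \<and> past \<omega>' = past \<omega>" \<omega>]) (simp add: \<omega>)
    then show ?thesis unfolding G_def by (intro Y_past[OF \<omega>]) simp_all
  qed
  then have "Y ` space P \<subseteq> G ` past ` space P" by blast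
  then have finY: "finite (Y ` space P)" using fin finite_surj by blast
  have atom: "{\<omega>' \<in> space P. past \<omega>' = past \<omega>} \<in> sets (hist t k)" for \<omega>
  proof -
    have "{\<omega>' \<in> space (hist t k). \<forall>p\<in>I. B (fst p) (snd p) \<omega>' = B (fst p) (snd p) \<omega>} \<in> sets (hist t k)"
    proof (rule sets.sets_Collect_finite_All)
      fix p assume "p \<in> I"
      then have "(fst p < t \<and> snd p < K) \<or> (fst p = t \<and> snd p < k)" by (auto simp: I_def)
      then have "B (fst p) (snd p) -` {B (fst p) (snd p) \<omega>} \<inter> space P \<in> sets (hist t k)"
        unfolding sets_hist by (intro sigma_sets.Basic) blast
      then show "{\<omega>' \<in> space (hist t k). B (fst p) (snd p) \<omega>' = B (fst p) (snd p) \<omega>} \<in> sets (hist t k)"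
        by (simp add: space_hist vimage_def Int_def conj_commute)
    qed (rule \<open>finite I\<close>)
    then show ?thesis by (simp add: space_hist past_eq)
  qed
  have "Y -` {y} \<inter> space P \<in> sets (hist t k)" for y
  proof -
    let ?C = "past ` (Y -` {y} \<inter> space P)"
    have "(\<Union>c\<in>?C. {\<omega>' \<in> space P. past \<omega>' = c}) \<in> sets (hist t k)"
    proof (rule sets.finite_UN)
      show "finite ?C" by (rule finite_subset[OF _ fin]) blast
      show "{\<omega>' \<in> space P. past \<omega>' = c} \<in> sets (hist t k)" if "c \<in> ?C" for c
        using that atom by blast
    qed
    moreover have "(\<Union>c\<in>?C. {\<omega>' \<in> space P. past \<omega>' = c}) = Y -` {y} \<inter> space P"
      by (auto dest: Y_past)
    ultimately show ?thesis by simp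
  qed
  then show ?thesis by (simp add: simple_function_def space_hist finY)
qed

lemma adapted_event:
  assumes "adapted t k Y" "k \<le> K"
  shows "{\<omega> \<in> space P. Y \<omega> = y} \<in> sets (hist t k)"
  using simple_functionD(2)[OF adapted_simple_function[OF assms], of "{y}"]
  by (simp add: space_hist vimage_def Int_def conj_commute)

lemma adapted_integrable:
  fixes Y :: "'w \<Rightarrow> real"
  assumes "adapted t k Y" "k \<le> K"
  shows "integrable P Y"
proof -
  have "simple_function P Y"
    using simple_function_subalgebra[OF adapted_simple_function[OF assms]] hist_subalgebra[OF assms(2)]
    by (auto simp: subalgebra_def)
  then show ?thesis by (rule integrable_simple_function) simp
qed

lemma indicator_integrable: "A \<in> sets P \<Longrightarrow> integrable P (indicat_real A)"
  by (simp add: integrable_real_indicator emeasure_eq_measure)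

lemma expectation_indicator: "A \<in> sets P \<Longrightarrow> expectation (indicat_real A) = prob A"
  by (simp add: Bochner_Integration.integral_indicator)

text \<open>
  The new batch is uniform and independent of the past: its conditional probabilities are constant,
  and integrating them over a past event gives the product.
\<close>

lemma prob_batch:
  assumes k: "k < K" and S: "S \<in> batches n b" and A: "A \<in> sets (hist t k)"
  shows "prob {\<omega> \<in> A. B t k \<omega> = S} = prob A / real (n choose b)"
proof -
  note sub = hist_subalgebra[OF less_imp_le[OF k], of t]
  interpret finite_measure_subalgebra P "hist t k"
    by unfold_locales (rule sub)
  have A': "A \<in> sets P" "A \<subseteq> space P"
    using A sub sets.sets_into_space by (auto simp: subalgebra_def)
  let ?E = "{\<omega> \<in> space P. B t k \<omega> = S}"
  have int: "integrable P (indicat_real ?E)" by (rule indicator_integrable[OF B_event[OF k]])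
  have "prob {\<omega> \<in> A. B t k \<omega> = S} = prob (A \<inter> ?E)"
    using A' by (intro arg_cong[where f = prob]) auto
  also have "\<dots> = expectation (indicat_real (A \<inter> ?E))"
    by (rule expectation_indicator[OF sets.Int[OF A'(1) B_event[OF k, of t S]], symmetric])
  also have "\<dots> = (\<integral>\<omega>\<in>A. indicat_real ?E \<omega> \<partial>P)"
    unfolding set_lebesgue_integral_def by (intro arg_cong[where f = expectation] ext) (auto simp: indicator_def)
  also have "\<dots> = (\<integral>\<omega>\<in>A. real_cond_exp P (hist t k) (indicat_real ?E) \<omega> \<partial>P)"
    by (rule real_cond_exp_intA[OF int A])
  also have "\<dots> = (\<integral>\<omega>\<in>A. 1 / real (n choose b) \<partial>P)"
    unfolding set_lebesgue_integral_def
    using B_unif[OF k S, of t] A' by (intro integral_cong_AE) (auto intro: borel_measurable_cond_exp2)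
  also have "\<dots> = prob A / real (n choose b)"
    using A' by (simp add: set_lebesgue_integral_def)
  finally show ?thesis .
qed

text \<open>
  Conditioning on the past, as a finite computation: the expectation is split over the values of
  \<open>Y\<close> and of the batch.
\<close>

lemma expectation_batch:
  fixes g :: "nat set \<Rightarrow> 'c \<Rightarrow> real"
  assumes k: "k < K" and Y: "adapted t k Y"
  shows "expectation (\<lambda>\<omega>. g (B t k \<omega>) (Y \<omega>)) = expectation (\<lambda>\<omega>. batch_avg n b (\<lambda>S. g S (Y \<omega>)))"
proof -
  let ?V = "Y ` space P"
  let ?A = "\<lambda>y. {\<omega> \<in> space P. Y \<omega> = y}"
  let ?AB = "\<lambda>y S. {\<omega> \<in> ?A y. B t k \<omega> = S}"
  have V: "finite ?V"
    using simple_functionD(1)[OF adapted_simple_function[OF Y]] k by (simp add: space_hist)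
  have hA: "?A y \<in> sets (hist t k)" for y using adapted_event[OF Y] k by simp
  then have A: "?A y \<in> sets P" for y
    using hist_subalgebra[of k t] k by (auto simp: subalgebra_def)
  have AB: "?AB y S \<in> sets P" for y S
    using sets.Int[OF A[of y] B_event[OF k, of t S]] by (simp add: Int_def conj_ac)
  have "expectation (\<lambda>\<omega>. g (B t k \<omega>) (Y \<omega>))
      = expectation (\<lambda>\<omega>. \<Sum>y\<in>?V. \<Sum>S\<in>batches n b. g S y * indicat_real (?AB y S) \<omega>)"
  proof (rule Bochner_Integration.integral_cong[OF refl])
    fix \<omega> assume \<omega>: "\<omega> \<in> space P"
    have "(\<Sum>y\<in>?V. \<Sum>S\<in>batches n b. g S y * indicat_real (?AB y S) \<omega>)
        = (\<Sum>y\<in>?V. if y = Y \<omega> then \<Sum>S\<in>batches n b. if S = B t k \<omega> then g S y else 0 else 0)"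
      using \<omega> by (intro sum.cong refl) (auto simp: indicator_def intro!: sum.cong)
    also have "\<dots> = g (B t k \<omega>) (Y \<omega>)"
      using \<omega> B_in_batches[OF k \<omega>] by (simp add: V finite_batches)
    finally show "g (B t k \<omega>) (Y \<omega>)
        = (\<Sum>y\<in>?V. \<Sum>S\<in>batches n b. g S y * indicat_real (?AB y S) \<omega>)" by simp
  qed
  also have "\<dots> = (\<Sum>y\<in>?V. \<Sum>S\<in>batches n b. g S y * prob (?AB y S))"
    using AB by (simp add: Bochner_Integration.integral_sum indicator_integrable)
  also have "\<dots> = (\<Sum>y\<in>?V. batch_avg n b (\<lambda>S. g S y) * prob (?A y))"
    using prob_batch[OF k _ hA]
    by (simp add: batch_avg_def sum_divide_distrib sum_distrib_right)
  also have "\<dots> = expectation (\<lambda>\<omega>. \<Sum>y\<in>?V. batch_avg n b (\<lambda>S. g S y) * indicat_real (?A y) \<omega>)"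
    using A by (simp add: Bochner_Integration.integral_sum indicator_integrable)
  also have "\<dots> = expectation (\<lambda>\<omega>. batch_avg n b (\<lambda>S. g S (Y \<omega>)))"
  proof (rule Bochner_Integration.integral_cong[OF refl])
    fix \<omega> assume \<omega>: "\<omega> \<in> space P"
    have "(\<Sum>y\<in>?V. batch_avg n b (\<lambda>S. g S y) * indicat_real (?A y) \<omega>)
        = (\<Sum>y\<in>?V. if y = Y \<omega> then batch_avg n b (\<lambda>S. g S y) else 0)"
      using \<omega> by (intro sum.cong refl) (auto simp: indicator_def)
    then show "(\<Sum>y\<in>?V. batch_avg n b (\<lambda>S. g S y) * indicat_real (?A y) \<omega>)
        = batch_avg n b (\<lambda>S. g S (Y \<omega>))" using \<omega> by (simp add: V)
  qed
  finally show ?thesis .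
qed

lemma expectation_single_batch:
  fixes g :: "nat set \<Rightarrow> real"
  assumes "k < K"
  shows "expectation (\<lambda>\<omega>. g (B t k \<omega>)) = batch_avg n b g"
  using expectation_batch[OF assms adapted_const[of t k "()"], of "\<lambda>S _. g S"] prob_space by simp

end

section \<open>One round\<close>

text \<open>
  Summation by parts. The coefficients \<open>1 / e k\<close> do not increase, so every interior term
  \<open>d (k + 1) (1 / e (k + 1) - 1 / e k)\<close> is nonpositive.
\<close>

lemma stepsize_telescope:
  fixes d e :: "nat \<Rightarrow> real"
  assumes "0 < emin" "\<And>k. k < K \<Longrightarrow> emin \<le> e k" "\<And>k. Suc k < K \<Longrightarrow> e k \<le> e (Suc k)" "\<And>k. 0 \<le> d k"
  shows "(\<Sum>k<K. (1 / e k) * (d k - d (Suc k))) \<le> d 0 / emin"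
proof -
  have pos: "0 < e k" if "k < K" for k using assms(1) assms(2)[OF that] by simp
  have claim: "(\<Sum>k<Suc j. (1 / e k) * (d k - d (Suc k))) \<le> d 0 / emin - d (Suc j) / e j" if "j < K" for j
    using that
  proof (induction j)
    case 0
    then have "d 0 / e 0 \<le> d 0 / emin"
      using assms by (intro divide_left_mono mult_pos_pos pos) auto
    then show ?case by (simp add: diff_divide_distrib)
  next
    case (Suc j)
    then have "d (Suc j) / e (Suc j) \<le> d (Suc j) / e j"
      using assms by (intro divide_left_mono mult_pos_pos pos) auto
    with Suc show ?case by (simp add: diff_divide_distrib)
  qed
  show ?thesis
  proof (cases K)
    case 0
    then show ?thesis using assms by simp
  next
    case (Suc j)
    then have "0 \<le> d (Suc j) / e j" using assms(4) pos[of j] by simp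
    with claim[of j] Suc show ?thesis by simp
  qed
qed

text \<open>
  The scheme of one round in expected values: \<open>a k\<close> is the gap, \<open>g k\<close> the Bregman distance of \<open>f\<close>
  to \<open>xstar\<close> and \<open>H k\<close> the table gap. Summing the recursion bounds the sum of \<open>H\<close> by the sum of \<open>g\<close>
  plus \<open>n / b\<close> times \<open>g 0\<close>. As \<open>g \<le> a\<close>, half of the sum of \<open>a\<close> reappears on the right and is
  absorbed on the left.
\<close>

lemma round_arithmetic:
  fixes a g H :: "nat \<Rightarrow> real" and n b K :: nat
  assumes b: "0 < b" "0 < n"
    and rec: "\<And>k. k < K \<Longrightarrow> H (Suc k) = (1 - real b / real n) * H k + real b / real n * g k"
    and H0: "H 0 = g 0" and HK: "0 \<le> H K"
    and g: "\<And>k. k \<le> K \<Longrightarrow> 0 \<le> g k" "\<And>k. k \<le> K \<Longrightarrow> g k \<le> a k"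
    and step: "(\<Sum>k<K. a (Suc k)) \<le> c * a 0 + (\<Sum>k<K. 1 / 4 * (g k + H k))"
    and K: "real K \<ge> 4 * ((real n / (4 * real b) + 1 / 2) + c)"
  shows "(\<Sum>k<K. a (Suc k)) \<le> real K / 2 * a 0"
proof -
  let ?S = "\<Sum>k<K. a (Suc k)"
  define p where "p = real b / real n"
  define q where "q = real n / real b"
  have pq: "q * p = 1" "0 < q" using b by (simp_all add: p_def q_def)
  have "H 0 - H K = (\<Sum>k<K. H k - H (Suc k))" by (rule sum_lessThan_telescope'[symmetric])
  also have "\<dots> = (\<Sum>k<K. p * (H k - g k))"
    by (rule sum.cong) (auto simp: rec p_def[symmetric] algebra_simps)
  also have "\<dots> = p * ((\<Sum>k<K. H k) - (\<Sum>k<K. g k))"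
    by (simp add: sum_distrib_left[symmetric] sum_subtractf)
  finally have "p * ((\<Sum>k<K. H k) - (\<Sum>k<K. g k)) \<le> g 0" using H0 HK by simp
  then have "q * (p * ((\<Sum>k<K. H k) - (\<Sum>k<K. g k))) \<le> q * g 0"
    using pq by (intro mult_left_mono) auto
  then have H: "(\<Sum>k<K. H k) \<le> (\<Sum>k<K. g k) + q * g 0"
    by (simp add: mult.assoc[symmetric] pq)
  have "(\<Sum>k<K. g k) \<le> (\<Sum>k<K. a k)" by (intro sum_mono g) auto
  also have "\<dots> \<le> (\<Sum>k<Suc K. a k)" using g[of K] by simp
  also have "\<dots> = a 0 + ?S" by (rule sum.lessThan_Suc_shift)
  finally have G: "(\<Sum>k<K. g k) \<le> a 0 + ?S" .
  have "q * g 0 \<le> q * a 0"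
    using g[of 0] pq by (intro mult_left_mono) auto
  with H G have "(\<Sum>k<K. g k) + (\<Sum>k<K. H k) \<le> 2 * (a 0 + ?S) + q * a 0" by argo
  then have "1 / 4 * ((\<Sum>k<K. g k) + (\<Sum>k<K. H k)) \<le> 1 / 4 * (2 * (a 0 + ?S) + q * a 0)" by simp
  moreover have "?S \<le> c * a 0 + 1 / 4 * ((\<Sum>k<K. g k) + (\<Sum>k<K. H k))"
    using step by (simp only: sum_distrib_left[symmetric] sum.distrib)
  ultimately have "?S \<le> c * a 0 + 1 / 4 * (2 * (a 0 + ?S) + q * a 0)"
    by (rule order_trans[OF _ add_left_mono, rotated])
  then have "?S \<le> 2 * ((q / 4 + 1 / 2) + c) * a 0"
    by (simp add: algebra_simps)
  also have "q / 4 = real n / (4 * real b)" by (simp add: q_def)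
  also have "2 * ((real n / (4 * real b) + 1 / 2) + c) * a 0 \<le> real K / 2 * a 0"
    using K g[of 0] by (intro mult_right_mono) auto
  finally show ?thesis .
qed

lemma iteration_count_pos:
  fixes n b K :: nat
  assumes "0 < mu" "0 < emin" "real K \<ge> 4 * ((real n / (4 * real b) + 1 / 2) + 1 / (mu * emin))"
  shows "0 < K"
proof -
  have "0 < 4 * ((real n / (4 * real b) + 1 / 2) + 1 / (mu * emin))"
    using assms(1,2) by (intro mult_pos_pos add_nonneg_pos add_nonneg_nonneg divide_pos_pos) auto
  with assms(3) show ?thesis by linarith
qed

lemma update_stepsize_simps [simp]:
  "it_point (update_stepsize eta_min eta_max m alpha theta k s) = it_point s"
  "it_table (update_stepsize eta_min eta_max m alpha theta k s) = it_table s"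
  "it_mean (update_stepsize eta_min eta_max m alpha theta k s) = it_mean s"
  by (simp_all add: update_stepsize_def Let_def)

text \<open>
  The random run is given by its recurrences rather than by the recursive functions that produce it,
  so that the arguments below refer to the states \<open>state t k\<close> of the rounds only.
\<close>

locale ada_restart = batch_process P n b K B
    + composite_problem n b fs h psi D xstar eta_min eta_max sigma_b Lbar M mu
  for P :: "'w measure"
    and n b K :: nat
    and B :: "nat \<Rightarrow> nat \<Rightarrow> 'w \<Rightarrow> nat set"
    and fs :: "nat \<Rightarrow> 'a::real_normed_vector \<Rightarrow> real"
    and h :: "'a \<Rightarrow> ereal"
    and psi :: "'a \<Rightarrow> real"
    and D :: "'a set"
    and xstar :: 'a
    and eta_min eta_max sigma_b Lbar M mu :: real +
  fixes m :: nat
    and alpha theta :: real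
    and xinit :: 'a
    and eta0 :: "nat \<Rightarrow> 'w \<Rightarrow> real"
    and state :: "nat \<Rightarrow> nat \<Rightarrow> 'w \<Rightarrow> 'a ada_state"
    and eta :: "nat \<Rightarrow> nat \<Rightarrow> 'w \<Rightarrow> real"
    and xr :: "nat \<Rightarrow> 'w \<Rightarrow> 'a"
  assumes xr_0: "\<And>\<omega>. xr 0 \<omega> = xinit"
    and xr_Suc: "\<And>t \<omega>. xr (Suc t) \<omega> = (1 / real K) *\<^sub>R (\<Sum>k=1..K. it_point (state t k \<omega>))"
    and state_0: "\<And>t \<omega>. state t 0 \<omega> = ada_init n fs (xr t \<omega>) (eta0 t \<omega>)"
    and state_Suc: "\<And>t k \<omega>. state t (Suc k) \<omega> = batch_step n b fs h psi (B t k \<omega>)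
          (update_stepsize eta_min eta_max m alpha theta k (state t k \<omega>))"
    and eta_eq: "\<And>t k \<omega>. eta t k \<omega> = it_eta (update_stepsize eta_min eta_max m alpha theta k (state t k \<omega>))"
    and eta0_meas: "\<And>t. eta0 t \<in> borel_measurable (batch_history P K B t 0)"
    and x_in_D: "\<And>t k. k \<le> K \<Longrightarrow> AE \<omega> in P. it_point (state t k \<omega>) \<in> D"
    and phi_in_D: "\<And>t k i. k \<le> K \<Longrightarrow> i \<in> {1..n} \<Longrightarrow> AE \<omega> in P. it_table (state t k \<omega>) i \<in> D"
    and eta_range: "\<And>t k \<omega>. k < K \<Longrightarrow> \<omega> \<in> space P \<Longrightarrow> eta_min \<le> eta t k \<omega> \<and> eta t k \<omega> \<le> eta_max"
    and eta_mono: "\<And>t k \<omega>. 0 < k \<Longrightarrow> k < K \<Longrightarrow> \<omega> \<in> space P \<Longrightarrow> eta t (k - 1) \<omega> \<le> eta t k \<omega>"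
    and K_large: "real K \<ge> 4 * ((real n / (4 * real b) + 1 / 2) + 1 / (mu * eta_min))"
begin

abbreviation pt :: "nat \<Rightarrow> nat \<Rightarrow> 'w \<Rightarrow> 'a" where
  "pt t k \<omega> \<equiv> it_point (state t k \<omega>)"

abbreviation tab :: "nat \<Rightarrow> nat \<Rightarrow> 'w \<Rightarrow> nat \<Rightarrow> 'a" where
  "tab t k \<omega> \<equiv> it_table (state t k \<omega>)"

lemma K_pos: "0 < K"
  by (rule iteration_count_pos[OF mu eta_min K_large])

lemma pt_0: "pt t 0 \<omega> = xr t \<omega>"
  and tab_0: "tab t 0 \<omega> = (\<lambda>i. xr t \<omega>)"
  by (simp_all add: state_0 ada_init_def)

lemma tab_Suc: "tab t (Suc k) \<omega> = (\<lambda>i. if i \<in> B t k \<omega> then pt t k \<omega> else tab t k \<omega> i)"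
  by (auto simp: state_Suc batch_step_def Let_def)

lemma mean_Suc: "it_mean (state t (Suc k) \<omega>) = it_mean (state t k \<omega>)
    + (1 / real n) *\<^sub>R (\<Sum>i\<in>B t k \<omega>. grad_shift (pt t k \<omega>) (tab t k \<omega>) i)"
  by (simp add: state_Suc batch_step_def Let_def grad_shift_def)

lemma pt_Suc: "pt t (Suc k) \<omega> = arg_min (prox_objective h psi
    ((1 / real b) *\<^sub>R (\<Sum>i\<in>B t k \<omega>. grad_shift (pt t k \<omega>) (tab t k \<omega>) i) + it_mean (state t k \<omega>))
    (eta t k \<omega>) (pt t k \<omega>)) (\<lambda>_. True)"
  by (simp add: state_Suc batch_step_def Let_def grad_shift_def eta_eq)

text \<open>
  The algorithm updates the mean gradient incrementally; it always is the mean of the gradients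
  stored in the table.
\<close>

lemma mean_eq:
  assumes "\<omega> \<in> space P"
  shows "k \<le> K \<Longrightarrow> it_mean (state t k \<omega>) = (1 / real n) *\<^sub>R (\<Sum>i=1..n. grad (fs i) (tab t k \<omega> i))"
proof (induction k)
  case 0
  then show ?case by (simp add: state_0 ada_init_def)
next
  case (Suc k)
  let ?S = "B t k \<omega>" and ?x = "pt t k \<omega>" and ?phi = "tab t k \<omega>"
  have S: "?S \<subseteq> {1..n}" using B_in_batches[of k \<omega> t] Suc assms by (auto simp: batches_def)
  have "(\<Sum>i=1..n. grad (fs i) (tab t (Suc k) \<omega> i))
      = (\<Sum>i=1..n. grad (fs i) (?phi i) + (if i \<in> ?S then grad_shift ?x ?phi i else 0))"
    unfolding tab_Suc by (rule sum.cong) (auto simp: grad_shift_def)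
  also have "\<dots> = (\<Sum>i=1..n. grad (fs i) (?phi i)) + (\<Sum>i\<in>?S. grad_shift ?x ?phi i)"
    using S by (simp add: sum.distrib sum.If_cases Int_absorb1)
  finally show ?case using Suc by (simp add: mean_Suc scaleR_add_right)
qed

lemma adapted_state_of_xr:
  assumes "adapted t 0 (xr t)"
  shows "adapted t k (state t k)"
proof (induction k)
  case 0
  have "adapted t 0 (\<lambda>\<omega>. ada_init n fs (xr t \<omega>) (eta0 t \<omega>))"
    by (rule adapted_comp2[OF assms adapted_of_measurable[OF eta0_meas]])
  then show ?case by (simp only: state_0[symmetric])
next
  case (Suc k)
  have "adapted t (Suc k) (\<lambda>\<omega>. batch_step n b fs h psi (B t k \<omega>)
      (update_stepsize eta_min eta_max m alpha theta k (state t k \<omega>)))"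
    by (rule adapted_comp2[OF adapted_batch adapted_mono[OF Suc]]) simp
  then show ?case by (simp only: state_Suc[symmetric])
qed

lemma adapted_xr: "adapted t 0 (xr t)"
proof (induction t)
  case 0
  have "xr 0 = (\<lambda>\<omega>. xinit)" by (simp add: xr_0 fun_eq_iff)
  then show ?case by (simp only: adapted_const)
next
  case (Suc t)
  have "adapted t K (pt t k)" if "k \<in> {1..K}" for k
    using that by (intro adapted_comp[OF adapted_mono[OF adapted_state_of_xr[OF Suc]]]) auto
  then have "adapted t K (\<lambda>\<omega>. \<Sum>k=1..K. pt t k \<omega>)" by (rule adapted_sum)
  then have "adapted t K (\<lambda>\<omega>. (1 / real K) *\<^sub>R (\<Sum>k=1..K. pt t k \<omega>))" by (rule adapted_comp)
  then have "adapted t K (xr (Suc t))" by (simp only: xr_Suc[symmetric])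
  then show ?case by (rule adapted_next_round)
qed

lemmas adapted_state = adapted_state_of_xr[OF adapted_xr]

lemma state_integrable:
  fixes g :: "'a ada_state \<Rightarrow> real"
  assumes "k \<le> K"
  shows "integrable P (\<lambda>\<omega>. g (state t k \<omega>))"
  by (rule adapted_integrable[OF adapted_comp[OF adapted_state] assms])

lemma batch_state_integrable:
  fixes g :: "nat set \<Rightarrow> 'a ada_state \<Rightarrow> real"
  assumes "k < K"
  shows "integrable P (\<lambda>\<omega>. g (B t k \<omega>) (state t k \<omega>))"
  using assms
  by (intro adapted_integrable[OF adapted_comp2[OF adapted_batch adapted_mono[OF adapted_state]]]) auto

text \<open>
  The almost sure hypothesis on iterates and tables, collected over the finitely many indices of one
  round, so that the inequalities of a round can be proved for each such outcome separately.
\<close>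

definition regular :: "nat \<Rightarrow> 'w \<Rightarrow> bool" where
  "regular t \<omega> \<longleftrightarrow> \<omega> \<in> space P \<and> (\<forall>k\<le>K. pt t k \<omega> \<in> D \<and> (\<forall>i\<in>{1..n}. tab t k \<omega> i \<in> D))"

lemma AE_regular: "AE \<omega> in P. regular t \<omega>"
proof -
  have "AE \<omega> in P. \<forall>k\<in>{..K}. pt t k \<omega> \<in> D"
    by (rule AE_finite_allI) (auto intro: x_in_D)
  moreover have "AE \<omega> in P. \<forall>k\<in>{..K}. \<forall>i\<in>{1..n}. tab t k \<omega> i \<in> D"
    by (intro AE_finite_allI phi_in_D) auto
  moreover have "AE \<omega> in P. \<omega> \<in> space P" by (rule AE_space)
  ultimately show ?thesis by eventually_elim (auto simp: regular_def)
qed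

definition noise_at :: "nat \<Rightarrow> nat \<Rightarrow> 'w \<Rightarrow> 'a \<Rightarrow>\<^sub>L real" where
  "noise_at t k \<omega> = noise (B t k \<omega>) (pt t k \<omega>) (tab t k \<omega>)"

lemma iterate_progress:
  assumes "regular t \<omega>" "k < K"
  shows "h (pt t (Suc k) \<omega>) < \<infinity>"
    and "gap (pt t (Suc k) \<omega>) \<le> blinfun_apply (noise_at t k \<omega>) (xstar - pt t k \<omega>)
           + noise_weight * (norm (noise_at t k \<omega>))\<^sup>2
           + (1 / eta t k \<omega>) * (bregman psi xstar (pt t k \<omega>) - bregman psi xstar (pt t (Suc k) \<omega>))"
proof -
  have \<omega>: "\<omega> \<in> space P" and D: "pt t k \<omega> \<in> D" "pt t (Suc k) \<omega> \<in> D" "\<And>i. i \<in> {1..n} \<Longrightarrow> tab t k \<omega> i \<in> D"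
    using assms by (auto simp: regular_def)
  have \<eta>: "eta_min \<le> eta t k \<omega>" "eta t k \<omega> \<le> eta_max" using eta_range[OF assms(2) \<omega>] by auto
  have "it_mean (state t k \<omega>) = (1 / real n) *\<^sub>R (\<Sum>i=1..n. grad (fs i) (tab t k \<omega> i))"
    using mean_eq[OF \<omega>] assms by simp
  note progress = prox_step_progress[OF B_in_batches[OF assms(2) \<omega>] D(1,3) \<eta>
      arg_cong[OF this, of "\<lambda>\<mu>. (1 / real b) *\<^sub>R (\<Sum>i\<in>B t k \<omega>. grad_shift (pt t k \<omega>) (tab t k \<omega>) i) + \<mu>"]
      pt_Suc D(2)]
  from progress show "h (pt t (Suc k) \<omega>) < \<infinity>"
    and "gap (pt t (Suc k) \<omega>) \<le> blinfun_apply (noise_at t k \<omega>) (xstar - pt t k \<omega>)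
           + noise_weight * (norm (noise_at t k \<omega>))\<^sup>2
           + (1 / eta t k \<omega>) * (bregman psi xstar (pt t k \<omega>) - bregman psi xstar (pt t (Suc k) \<omega>))"
    unfolding noise_at_def by blast+
qed

lemma round_pathwise:
  assumes "regular t \<omega>"
  shows "(\<Sum>k<K. gap (pt t (Suc k) \<omega>)) \<le> bregman psi xstar (xr t \<omega>) / eta_min
     + (\<Sum>k<K. blinfun_apply (noise_at t k \<omega>) (xstar - pt t k \<omega>) + noise_weight * (norm (noise_at t k \<omega>))\<^sup>2)"
proof -
  let ?d = "\<lambda>k. bregman psi xstar (pt t k \<omega>)"
  have \<omega>: "\<omega> \<in> space P" using assms by (simp add: regular_def)
  have "(\<Sum>k<K. gap (pt t (Suc k) \<omega>)) \<le> (\<Sum>k<K. (blinfun_apply (noise_at t k \<omega>) (xstar - pt t k \<omega>)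
      + noise_weight * (norm (noise_at t k \<omega>))\<^sup>2) + (1 / eta t k \<omega>) * (?d k - ?d (Suc k)))"
    by (intro sum_mono iterate_progress(2)[OF assms]) simp
  moreover have "(\<Sum>k<K. (1 / eta t k \<omega>) * (?d k - ?d (Suc k))) \<le> ?d 0 / eta_min"
  proof (rule stepsize_telescope[OF eta_min])
    show "eta_min \<le> eta t k \<omega>" if "k < K" for k using eta_range[OF that \<omega>] by simp
    show "eta t k \<omega> \<le> eta t (Suc k) \<omega>" if "Suc k < K" for k using eta_mono[OF _ that \<omega>] by simp
  qed (rule psi_nonneg)
  ultimately show ?thesis unfolding sum.distrib by (simp add: pt_0)
qed

lemma expectation_noise: "k < K \<Longrightarrow> expectation (\<lambda>\<omega>. blinfun_apply (noise_at t k \<omega>) (xstar - pt t k \<omega>)) = 0"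
  unfolding noise_at_def
  by (subst expectation_batch[OF _ adapted_state,
        of k "\<lambda>S s. blinfun_apply (noise S (it_point s) (it_table s)) (xstar - it_point s)"])
    (simp_all only: noise_unbiased, simp)

lemma expectation_noise_square:
  assumes k: "k < K"
  shows "expectation (\<lambda>\<omega>. noise_weight * (norm (noise_at t k \<omega>))\<^sup>2)
    \<le> 1 / 4 * (expectation (\<lambda>\<omega>. bregman f (pt t k \<omega>) xstar) + expectation (\<lambda>\<omega>. table_gap (tab t k \<omega>)))"
proof -
  have "expectation (\<lambda>\<omega>. noise_weight * (norm (noise_at t k \<omega>))\<^sup>2)
      = noise_weight * expectation (\<lambda>\<omega>. (norm (noise_at t k \<omega>))\<^sup>2)"
    by simp
  also have "\<dots> = noise_weight * expectation (\<lambda>\<omega>. batch_avg n b (\<lambda>S. (norm (noise S (pt t k \<omega>) (tab t k \<omega>)))\<^sup>2))"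
    unfolding noise_at_def
    by (subst expectation_batch[OF k adapted_state,
        of "\<lambda>S s. (norm (noise S (it_point s) (it_table s)))\<^sup>2"]) (rule refl)
  also have "\<dots> = expectation (\<lambda>\<omega>. noise_weight * batch_avg n b (\<lambda>S. (norm (noise S (pt t k \<omega>) (tab t k \<omega>)))\<^sup>2))"
    by simp
  also have "\<dots> \<le> expectation (\<lambda>\<omega>. 1 / 4 * (bregman f (pt t k \<omega>) xstar + table_gap (tab t k \<omega>)))"
  proof (rule integral_mono_AE)
    show "AE \<omega> in P. noise_weight * batch_avg n b (\<lambda>S. (norm (noise S (pt t k \<omega>) (tab t k \<omega>)))\<^sup>2)
        \<le> 1 / 4 * (bregman f (pt t k \<omega>) xstar + table_gap (tab t k \<omega>))"
      using AE_regular[of t]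
    proof eventually_elim
      case (elim \<omega>)
      with k show ?case by (intro noise_second_moment) (auto simp: regular_def)
    qed
    show "integrable P (\<lambda>\<omega>. noise_weight * batch_avg n b (\<lambda>S. (norm (noise S (pt t k \<omega>) (tab t k \<omega>)))\<^sup>2))"
      using k by (intro state_integrable[where
        g = "\<lambda>s. noise_weight * batch_avg n b (\<lambda>S. (norm (noise S (it_point s) (it_table s)))\<^sup>2)"]) simp
    show "integrable P (\<lambda>\<omega>. 1 / 4 * (bregman f (pt t k \<omega>) xstar + table_gap (tab t k \<omega>)))"
      using k by (intro state_integrable[where
        g = "\<lambda>s. 1 / 4 * (bregman f (it_point s) xstar + table_gap (it_table s))"]) simp
  qed
  also have "\<dots> = 1 / 4 * (expectation (\<lambda>\<omega>. bregman f (pt t k \<omega>) xstar) + expectation (\<lambda>\<omega>. table_gap (tab t k \<omega>)))"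
    using k state_integrable[where g = "\<lambda>s. bregman f (it_point s) xstar"]
      state_integrable[where g = "\<lambda>s. table_gap (it_table s)"] by simp
  finally show ?thesis .
qed

lemma expectation_table_gap:
  assumes k: "k < K"
  shows "expectation (\<lambda>\<omega>. table_gap (tab t (Suc k) \<omega>))
    = (1 - real b / real n) * expectation (\<lambda>\<omega>. table_gap (tab t k \<omega>))
      + real b / real n * expectation (\<lambda>\<omega>. bregman f (pt t k \<omega>) xstar)"
proof -
  have "expectation (\<lambda>\<omega>. table_gap (tab t (Suc k) \<omega>))
      = expectation (\<lambda>\<omega>. (1 - real b / real n) * table_gap (tab t k \<omega>) + real b / real n * bregman f (pt t k \<omega>) xstar)"
    unfolding tab_Suc table_gap_update[symmetric]
    by (rule expectation_batch[OF k adapted_state,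
        of "\<lambda>S s. table_gap (\<lambda>i. if i \<in> S then it_point s else it_table s i)"])
  also have "\<dots> = (1 - real b / real n) * expectation (\<lambda>\<omega>. table_gap (tab t k \<omega>))
      + real b / real n * expectation (\<lambda>\<omega>. bregman f (pt t k \<omega>) xstar)"
    using k state_integrable[where g = "\<lambda>s. bregman f (it_point s) xstar"]
      state_integrable[where g = "\<lambda>s. table_gap (it_table s)"] by simp
  finally show ?thesis .
qed

text \<open>
  The assumption \<open>dom\<close> covers the initial point; each later iterate is a minimizer of
  a proximal problem, so \<open>h\<close> is finite there.
\<close>

lemma round_sum:
  assumes dom: "AE \<omega> in P. h (xr t \<omega>) < \<infinity>"
  shows "(\<Sum>k<K. expectation (\<lambda>\<omega>. gap (pt t (Suc k) \<omega>))) \<le> real K / 2 * expectation (\<lambda>\<omega>. gap (xr t \<omega>))"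
proof -
  define a where "a k = expectation (\<lambda>\<omega>. gap (pt t k \<omega>))" for k
  define g where "g k = expectation (\<lambda>\<omega>. bregman f (pt t k \<omega>) xstar)" for k
  define H where "H k = expectation (\<lambda>\<omega>. table_gap (tab t k \<omega>))" for k
  note int_gap = state_integrable[where g = "\<lambda>s. gap (it_point s)"]
  note int_f = state_integrable[where g = "\<lambda>s. bregman f (it_point s) xstar"]
  note int_psi = state_integrable[of 0, where g = "\<lambda>s. bregman psi xstar (it_point s)"]
  note int_noise = batch_state_integrable[where
      g = "\<lambda>S s. blinfun_apply (noise S (it_point s) (it_table s)) (xstar - it_point s)", folded noise_at_def]
    batch_state_integrable[where
      g = "\<lambda>S s. noise_weight * (norm (noise S (it_point s) (it_table s)))\<^sup>2", folded noise_at_def]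
  have "(\<Sum>k<K. a (Suc k)) \<le> real K / 2 * a 0"
  proof (rule round_arithmetic[where g = g and H = H and c = "1 / (mu * eta_min)"])
    show "0 < b" "0 < n" using b n_pos by auto
    show "H (Suc k) = (1 - real b / real n) * H k + real b / real n * g k" if "k < K" for k
      unfolding H_def g_def by (rule expectation_table_gap[OF that])
    show "H 0 = g 0" by (simp add: H_def g_def tab_0 pt_0 table_gap_const)
    show "0 \<le> H K" unfolding H_def
    proof (rule integral_nonneg_AE)
      show "AE \<omega> in P. 0 \<le> table_gap (tab t K \<omega>)"
        using AE_regular[of t] by eventually_elim (auto simp: regular_def intro!: table_gap_nonneg)
    qed
    show "0 \<le> g k" if "k \<le> K" for k unfolding g_def
    proof (rule integral_nonneg_AE)
      show "AE \<omega> in P. 0 \<le> bregman f (pt t k \<omega>) xstar"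
        using AE_regular[of t] by eventually_elim (use that in \<open>auto simp: regular_def intro!: f_bregman_nonneg xstar(2)\<close>)
    qed
    show "g k \<le> a k" if "k \<le> K" for k unfolding g_def a_def
    proof (rule integral_mono_AE[OF int_f[OF that] int_gap[OF that]])
      show "AE \<omega> in P. bregman f (pt t k \<omega>) xstar \<le> gap (pt t k \<omega>)"
        using AE_regular[of t] dom
      proof eventually_elim
        case (elim \<omega>)
        have "h (pt t k \<omega>) < \<infinity>"
        proof (cases k)
          case 0
          then show ?thesis using elim(2) by (simp only: pt_0)
        next
          case (Suc j)
          then show ?thesis using iterate_progress(1)[OF elim(1), of j] that by simp
        qed
        then show ?case by (rule bregman_le_gap)
      qed
    qed
    show "(\<Sum>k<K. a (Suc k)) \<le> 1 / (mu * eta_min) * a 0 + (\<Sum>k<K. 1 / 4 * (g k + H k))"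
    proof -
      have "(\<Sum>k<K. a (Suc k)) = expectation (\<lambda>\<omega>. \<Sum>k<K. gap (pt t (Suc k) \<omega>))"
        unfolding a_def by (rule Bochner_Integration.integral_sum[symmetric], rule int_gap) auto
      also have "\<dots> \<le> expectation (\<lambda>\<omega>. bregman psi xstar (xr t \<omega>) / eta_min
         + (\<Sum>k<K. blinfun_apply (noise_at t k \<omega>) (xstar - pt t k \<omega>) + noise_weight * (norm (noise_at t k \<omega>))\<^sup>2))"
      proof (rule integral_mono_AE)
        show "integrable P (\<lambda>\<omega>. \<Sum>k<K. gap (pt t (Suc k) \<omega>))"
          by (rule Bochner_Integration.integrable_sum, rule int_gap) auto
        show "integrable P (\<lambda>\<omega>. bregman psi xstar (xr t \<omega>) / eta_min
          + (\<Sum>k<K. blinfun_apply (noise_at t k \<omega>) (xstar - pt t k \<omega>) + noise_weight * (norm (noise_at t k \<omega>))\<^sup>2))"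
          using int_psi[of t, unfolded pt_0] int_noise
          by (intro Bochner_Integration.integrable_add Bochner_Integration.integrable_sum
              Bochner_Integration.integrable_divide) auto
        show "AE \<omega> in P. (\<Sum>k<K. gap (pt t (Suc k) \<omega>)) \<le> bregman psi xstar (xr t \<omega>) / eta_min
          + (\<Sum>k<K. blinfun_apply (noise_at t k \<omega>) (xstar - pt t k \<omega>) + noise_weight * (norm (noise_at t k \<omega>))\<^sup>2)"
          using AE_regular[of t] by eventually_elim (rule round_pathwise)
      qed
      also have "\<dots> = expectation (\<lambda>\<omega>. bregman psi xstar (xr t \<omega>)) / eta_min
         + (\<Sum>k<K. expectation (\<lambda>\<omega>. blinfun_apply (noise_at t k \<omega>) (xstar - pt t k \<omega>))
              + expectation (\<lambda>\<omega>. noise_weight * (norm (noise_at t k \<omega>))\<^sup>2))"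
      proof (subst Bochner_Integration.integral_add)
        show "integrable P (\<lambda>\<omega>. bregman psi xstar (xr t \<omega>) / eta_min)"
          using int_psi[of t, unfolded pt_0] by simp
        show "integrable P (\<lambda>\<omega>. \<Sum>k<K. blinfun_apply (noise_at t k \<omega>) (xstar - pt t k \<omega>)
            + noise_weight * (norm (noise_at t k \<omega>))\<^sup>2)"
          using int_noise by (intro Bochner_Integration.integrable_add Bochner_Integration.integrable_sum) auto
        have "expectation (\<lambda>\<omega>. \<Sum>k<K. blinfun_apply (noise_at t k \<omega>) (xstar - pt t k \<omega>)
            + noise_weight * (norm (noise_at t k \<omega>))\<^sup>2)
          = (\<Sum>k<K. expectation (\<lambda>\<omega>. blinfun_apply (noise_at t k \<omega>) (xstar - pt t k \<omega>)
            + noise_weight * (norm (noise_at t k \<omega>))\<^sup>2))"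
          using int_noise by (intro Bochner_Integration.integral_sum Bochner_Integration.integrable_add) auto
        also have "\<dots> = (\<Sum>k<K. expectation (\<lambda>\<omega>. blinfun_apply (noise_at t k \<omega>) (xstar - pt t k \<omega>))
              + expectation (\<lambda>\<omega>. noise_weight * (norm (noise_at t k \<omega>))\<^sup>2))"
          using int_noise by (intro sum.cong refl Bochner_Integration.integral_add) auto
        finally show "expectation (\<lambda>\<omega>. bregman psi xstar (xr t \<omega>) / eta_min)
          + expectation (\<lambda>\<omega>. \<Sum>k<K. blinfun_apply (noise_at t k \<omega>) (xstar - pt t k \<omega>)
            + noise_weight * (norm (noise_at t k \<omega>))\<^sup>2)
          = expectation (\<lambda>\<omega>. bregman psi xstar (xr t \<omega>)) / eta_min
            + (\<Sum>k<K. expectation (\<lambda>\<omega>. blinfun_apply (noise_at t k \<omega>) (xstar - pt t k \<omega>))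
              + expectation (\<lambda>\<omega>. noise_weight * (norm (noise_at t k \<omega>))\<^sup>2))"
          by simp
      qed
      also have "\<dots> \<le> expectation (\<lambda>\<omega>. bregman psi xstar (xr t \<omega>)) / eta_min + (\<Sum>k<K. 1 / 4 * (g k + H k))"
        unfolding g_def H_def
        by (intro add_left_mono sum_mono)
          (simp only: lessThan_iff expectation_noise add_0 expectation_noise_square)
      also have "expectation (\<lambda>\<omega>. bregman psi xstar (xr t \<omega>)) / eta_min \<le> 1 / (mu * eta_min) * a 0"
      proof -
        have "expectation (\<lambda>\<omega>. mu * bregman psi xstar (xr t \<omega>)) \<le> a 0"
          unfolding a_def pt_0
        proof (rule integral_mono_AE)
          show "integrable P (\<lambda>\<omega>. mu * bregman psi xstar (xr t \<omega>))"
            using int_psi[of t, unfolded pt_0] by simp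
          show "integrable P (\<lambda>\<omega>. gap (xr t \<omega>))" using int_gap[of 0 t, unfolded pt_0] by simp
          show "AE \<omega> in P. mu * bregman psi xstar (xr t \<omega>) \<le> gap (xr t \<omega>)"
            using AE_regular[of t] dom
          proof eventually_elim
            case (elim \<omega>)
            then have "xr t \<omega> \<in> D" unfolding regular_def pt_0[symmetric] by blast
            then show ?case using elim(2) by (rule growth_gap)
          qed
        qed
        then show ?thesis using mu eta_min by (simp add: field_simps)
      qed
      finally show ?thesis by simp
    qed
    show "4 * ((real n / (4 * real b) + 1 / 2) + 1 / (mu * eta_min)) \<le> real K" by (rule K_large)
  qed
  then show ?thesis by (simp only: a_def pt_0)
qed

lemma averaged_iterate:
  assumes "regular t \<omega>"
  shows "h (xr (Suc t) \<omega>) < \<infinity>"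
    and "gap (xr (Suc t) \<omega>) \<le> 1 / real K * (\<Sum>k<K. gap (pt t (Suc k) \<omega>))"
proof -
  have xr: "xr (Suc t) \<omega> = (\<Sum>k<K. (1 / real K) *\<^sub>R pt t (Suc k) \<omega>)"
    unfolding xr_Suc scaleR_sum_right[symmetric]
    by (intro arg_cong[where f = "scaleR _"] sum.reindex_bij_witness[of _ Suc "\<lambda>k. k - 1"]) auto
  let ?C = "{x \<in> D. h x < \<infinity>}"
  have C: "pt t (Suc k) \<omega> \<in> ?C" if "k \<in> {..<K}" for k
    using iterate_progress(1)[OF assms, of k] assms that by (auto simp: regular_def)
  have nonempty: "{..<K} \<noteq> {}" using K_pos by auto
  have weights: "(\<Sum>k<K. 1 / real K) = 1" using K_pos by simp
  have "(\<Sum>k<K. (1 / real K) *\<^sub>R pt t (Suc k) \<omega>) \<in> ?C"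
    by (rule convex_sum[OF _ convex_on_imp_convex[OF gap_convex] weights _ C]) auto
  then show "h (xr (Suc t) \<omega>) < \<infinity>" unfolding xr by blast
  have "gap (\<Sum>k<K. (1 / real K) *\<^sub>R pt t (Suc k) \<omega>) \<le> (\<Sum>k<K. 1 / real K * gap (pt t (Suc k) \<omega>))"
    by (rule convex_on_sum[OF _ nonempty gap_convex weights _ C]) auto
  then show "gap (xr (Suc t) \<omega>) \<le> 1 / real K * (\<Sum>k<K. gap (pt t (Suc k) \<omega>))"
    unfolding xr sum_distrib_left .
qed

lemma xr_integrable: "integrable P (\<lambda>\<omega>. gap (xr t \<omega>))"
  using state_integrable[of 0 "\<lambda>s. gap (it_point s)" t, unfolded pt_0] by simp

lemma round_halves_gap:
  assumes dom: "AE \<omega> in P. h (xr t \<omega>) < \<infinity>"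
  shows "expectation (\<lambda>\<omega>. gap (xr (Suc t) \<omega>)) \<le> 1 / 2 * expectation (\<lambda>\<omega>. gap (xr t \<omega>))"
proof -
  note int_gap = state_integrable[where g = "\<lambda>s. gap (it_point s)"]
  have int: "integrable P (\<lambda>\<omega>. 1 / real K * (\<Sum>k<K. gap (pt t (Suc k) \<omega>)))"
    by (rule integrable_mult_right, rule Bochner_Integration.integrable_sum, rule int_gap) auto
  have "expectation (\<lambda>\<omega>. gap (xr (Suc t) \<omega>)) \<le> expectation (\<lambda>\<omega>. 1 / real K * (\<Sum>k<K. gap (pt t (Suc k) \<omega>)))"
  proof (rule integral_mono_AE[OF xr_integrable int])
    show "AE \<omega> in P. gap (xr (Suc t) \<omega>) \<le> 1 / real K * (\<Sum>k<K. gap (pt t (Suc k) \<omega>))"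
      using AE_regular[of t] by eventually_elim (rule averaged_iterate(2))
  qed
  also have "\<dots> = 1 / real K * expectation (\<lambda>\<omega>. \<Sum>k<K. gap (pt t (Suc k) \<omega>))"
    by (rule integral_mult_right_zero)
  also have "\<dots> = 1 / real K * (\<Sum>k<K. expectation (\<lambda>\<omega>. gap (pt t (Suc k) \<omega>)))"
    by (subst Bochner_Integration.integral_sum, rule int_gap) auto
  also have "\<dots> \<le> 1 / real K * (real K / 2 * expectation (\<lambda>\<omega>. gap (xr t \<omega>)))"
    by (intro mult_left_mono round_sum dom) simp
  also have "\<dots> = 1 / 2 * expectation (\<lambda>\<omega>. gap (xr t \<omega>))" using K_pos by simp
  finally show ?thesis .
qed

theorem restart_linear_rate:
  assumes "h xinit < \<infinity>"
  shows "(AE \<omega> in P. h (xr \<tau> \<omega>) < \<infinity>) \<and> expectation (\<lambda>\<omega>. gap (xr \<tau> \<omega>)) \<le> 1 / 2 ^ \<tau> * gap xinit"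
proof (induction \<tau>)
  case 0
  then show ?case using assms by (simp add: xr_0 prob_space)
next
  case (Suc \<tau>)
  have "AE \<omega> in P. h (xr (Suc \<tau>) \<omega>) < \<infinity>"
    using AE_regular[of \<tau>] by eventually_elim (rule averaged_iterate(1))
  moreover have "expectation (\<lambda>\<omega>. gap (xr (Suc \<tau>) \<omega>)) \<le> 1 / 2 * expectation (\<lambda>\<omega>. gap (xr \<tau> \<omega>))"
    using Suc by (intro round_halves_gap) simp
  ultimately show ?case using Suc by simp
qed

end

section \<open>Convergence of the restart scheme\<close>

text \<open>
  The positive and negative parts of an integrable variable have finite expectations, so the
  difference in \<open>ereal_expectation\<close> is not of the form \<open>\<infinity> - \<infinity>\<close>.
\<close>

lemma ereal_expectation_real:
  assumes "integrable P z" "AE \<omega> in P. Z \<omega> = ereal (z \<omega>)"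
  shows "ereal_expectation P Z = ereal (integral\<^sup>L P z)"
proof -
  have pos: "(\<integral>\<^sup>+\<omega>. e2ennreal (Z \<omega>) \<partial>P) = (\<integral>\<^sup>+\<omega>. ennreal (z \<omega>) \<partial>P)"
    by (rule nn_integral_cong_AE) (use assms(2) in eventually_elim, simp)
  have neg: "(\<integral>\<^sup>+\<omega>. e2ennreal (- Z \<omega>) \<partial>P) = (\<integral>\<^sup>+\<omega>. ennreal (- z \<omega>) \<partial>P)"
    by (rule nn_integral_cong_AE) (use assms(2) in eventually_elim, simp)
  have fin: "(\<integral>\<^sup>+\<omega>. ennreal (z \<omega>) \<partial>P) < \<infinity>" "(\<integral>\<^sup>+\<omega>. ennreal (- z \<omega>) \<partial>P) < \<infinity>"
    using assms(1) by (auto simp: real_integrable_def less_top)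
  have conv: "enn2ereal u = ereal (enn2real u)" if "u < \<infinity>" for u
    using that by (cases u) auto
  show ?thesis
    unfolding ereal_expectation_def pos neg conv[OF fin(1)] conv[OF fin(2)]
    by (simp add: real_lebesgue_integral_def[OF assms(1)])
qed

theorem theorem3p8:
  fixes n b m K \<tau> :: nat
    and fs :: "nat \<Rightarrow> 'a::real_normed_vector \<Rightarrow> real"
    and h :: "'a \<Rightarrow> ereal"
    and psi f :: "'a \<Rightarrow> real"
    and F :: "'a \<Rightarrow> ereal"
    and X D :: "'a set"
    and xinit xstar :: 'a
    and eta_min eta_max alpha theta sigma_b Lbar Llow M mu :: real
    and P :: "'w measure"
    and B :: "nat \<Rightarrow> nat \<Rightarrow> 'w \<Rightarrow> nat set"
    and eta0 :: "nat \<Rightarrow> 'w \<Rightarrow> real"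
    and state :: "nat \<Rightarrow> nat \<Rightarrow> 'w \<Rightarrow> 'a ada_state"
    and eta :: "nat \<Rightarrow> nat \<Rightarrow> 'w \<Rightarrow> real"
    and xr :: "nat \<Rightarrow> 'w \<Rightarrow> 'a"
  defines "f \<equiv> avg_fun n fs"
    and "F \<equiv> composite n fs h"
    \<comment> \<open>state at the start of iteration k of round t\<close>
    and "state \<equiv> (\<lambda>t k \<omega>. restart_state n b fs h psi eta_min eta_max m alpha theta K
                     xinit (\<lambda>s. eta0 s \<omega>) (\<lambda>s j. B s j \<omega>) t k)"
    \<comment> \<open>step size used in iteration k of round t\<close>
    and "eta \<equiv> (\<lambda>t k \<omega>. it_eta (update_stepsize eta_min eta_max m alpha theta k (state t k \<omega>)))"
    \<comment> \<open>initial point of round t\<close>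
    and "xr \<equiv> (\<lambda>t \<omega>. restart_point n b fs h psi eta_min eta_max m alpha theta K
                     xinit (\<lambda>s. eta0 s \<omega>) (\<lambda>s j. B s j \<omega>) t)"
  assumes finite_dim: "\<exists>S::'a set. finite S \<and> span S = UNIV"
    and n: "n \<ge> 1"
    \<comment> \<open>the set on which the problem is smooth\<close>
    and X: "X \<noteq> {}" "convex X" "open X"
    and fs_diff: "\<And>i x. i \<in> {1..n} \<Longrightarrow> x \<in> X \<Longrightarrow> fs i differentiable (at x)"
    and f_lsc: "lsc_on X f"
    and f_C1: "continuous_on X (grad f)"
    \<comment> \<open>parameters of the algorithm\<close>
    and b: "1 \<le> b" "b \<le> n"
    and eta_bounds: "0 < eta_min" "eta_min \<le> eta_max"
    and m: "m \<ge> 1"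
    and alpha: "alpha > 0"
    and theta: "theta > 0"
    \<comment> \<open>probability space, batches and initial step sizes of the rounds\<close>
    and prob: "prob_space P"
    and B_rv: "\<And>t k. k < K \<Longrightarrow> B t k \<in> measurable P (count_space {S. S \<subseteq> {1..n} \<and> card S = b})"
    and eta0_meas: "\<And>t. eta0 t \<in> borel_measurable (batch_history P K B t 0)"
    and eta0_bounds: "\<And>t \<omega>. \<omega> \<in> space P \<Longrightarrow> eta_min \<le> eta0 t \<omega> \<and> eta0 t \<omega> \<le> eta_max"
    \<comment> \<open>Assumption 1\<close>
    and psi_diff: "\<And>x. psi differentiable (at x)"
    and psi_C1: "continuous_on UNIV (grad psi)"
    and psi_sc: "\<And>x y. bregman psi x y \<ge> 1 / 2 * (norm (x - y))\<^sup>2"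
    and h: "proper_closed_convex h"
    and prox_unique: "\<And>x G e. x \<in> D \<Longrightarrow> e \<in> {eta_min..eta_max} \<Longrightarrow>
          \<exists>!u. is_arg_min (prox_objective h psi G e x) (\<lambda>_. True) u"
    \<comment> \<open>Assumption 2\<close>
    and D: "bounded D" "convex D" "D \<subseteq> X"
    and x_in_D: "\<And>t k. k \<le> K \<Longrightarrow> AE \<omega> in P. it_point (state t k \<omega>) \<in> D"
    and phi_in_D: "\<And>t k i. k \<le> K \<Longrightarrow> i \<in> {1..n} \<Longrightarrow> AE \<omega> in P. it_table (state t k \<omega>) i \<in> D"
    and xstar: "is_arg_min F (\<lambda>_. True) xstar" "xstar \<in> D"
    \<comment> \<open>Assumption 3\<close>
    and B_unif: "\<And>t k S. k < K \<Longrightarrow> S \<subseteq> {1..n} \<Longrightarrow> card S = b \<Longrightarrow>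
          AE \<omega> in P. real_cond_exp P (batch_history P K B t k)
                       (indicat_real {\<omega> \<in> space P. B t k \<omega> = S}) \<omega> = 1 / real (n choose b)"
    and sigma_b: "sigma_b \<ge> 1"
    and B_var: "\<And>t k (v :: nat \<Rightarrow> 'a \<Rightarrow>\<^sub>L real) vbar. k < K \<Longrightarrow>
          vbar = (1 / real n) *\<^sub>R (\<Sum>i=1..n. v i) \<Longrightarrow>
          prob_space.expectation P
            (\<lambda>\<omega>. (norm ((1 / real b) *\<^sub>R (\<Sum>i\<in>B t k \<omega>. v i - vbar)))\<^sup>2)
          \<le> sigma_b / (real b * real n) * (\<Sum>i=1..n. (norm (v i - vbar))\<^sup>2)"
    \<comment> \<open>Assumption 4\<close>
    and L: "Lbar > 0" "Llow \<ge> 0"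
    and rel_smooth: "\<And>x y. x \<in> D \<Longrightarrow> y \<in> D \<Longrightarrow>
          - Llow * bregman psi x y \<le> f x - f y - blinfun_apply (grad f y) (x - y) \<and>
          f x - f y - blinfun_apply (grad f y) (x - y) \<le> Lbar * bregman psi x y"
    \<comment> \<open>Assumption 5\<close>
    and M: "M \<ge> 0"
    and fs_lip: "\<And>i x y. i \<in> {1..n} \<Longrightarrow> x \<in> D \<Longrightarrow> y \<in> D \<Longrightarrow>
          norm (grad (fs i) x - grad (fs i) y) \<le> M * norm (x - y)"
    \<comment> \<open>Assumption 6\<close>
    and fs_convex: "\<And>i. i \<in> {1..n} \<Longrightarrow> convex_on D (fs i)"
    and fs_cocoercive: "\<And>i x y. i \<in> {1..n} \<Longrightarrow> x \<in> D \<Longrightarrow> y \<in> D \<Longrightarrow>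
          (norm (grad (fs i) x - grad (fs i) y))\<^sup>2
          \<le> 2 * M * (fs i x - fs i y - blinfun_apply (grad (fs i) y) (x - y))"
    \<comment> \<open>hypotheses of the theorem\<close>
    and eta_max_le: "eta_max \<le> 1 / (Lbar + 32 * sigma_b * M / real b)"
    and eta_range: "\<And>t k \<omega>. k < K \<Longrightarrow> \<omega> \<in> space P \<Longrightarrow> eta_min \<le> eta t k \<omega> \<and> eta t k \<omega> \<le> eta_max"
    and eta_mono: "\<And>t k \<omega>. 0 < k \<Longrightarrow> k < K \<Longrightarrow> \<omega> \<in> space P \<Longrightarrow> eta t (k - 1) \<omega> \<le> eta t k \<omega>"
    and mu: "mu > 0"
    and growth: "\<And>x. x \<in> D \<Longrightarrow> F x - F xstar \<ge> ereal (mu * bregman psi xstar x)"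
    and K: "real K \<ge> 4 * ((real n / (4 * real b) + 1 / 2) + 1 / (mu * eta_min))"
  shows "ereal_expectation P (\<lambda>\<omega>. F (xr \<tau> \<omega>)) - F xstar
         \<le> ereal (1 / 2 ^ \<tau>) * (F xinit - F xstar)"
proof (cases "h xinit < \<infinity>")
  case dom: True
  have nb: "{S. S \<subseteq> {1..n} \<and> card S = b} = batches n b"
    by (simp add: batches_def)
  have smooth: "bregman f x y \<le> Lbar * bregman psi x y" if "x \<in> D" "y \<in> D" for x y
    using rel_smooth[OF that] by (simp add: bregman_def)
  have K_pos: "0 < K"
    by (rule iteration_count_pos[OF mu eta_bounds(1) K])
  interpret prob_space P by (rule prob)
  interpret batch_process P n b K B
  proof
    show "b \<le> n" by (rule b(2))
    show "B t k \<in> measurable P (count_space (batches n b))" if "k < K" for t k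
      using B_rv[OF that] by (simp only: nb)
    show "AE \<omega> in P. real_cond_exp P (batch_history P K B t k)
        (indicat_real {\<omega> \<in> space P. B t k \<omega> = S}) \<omega> = 1 / real (n choose b)"
      if "k < K" "S \<in> batches n b" for t k S
      using B_unif[OF that(1), of S t] that(2) by (simp add: batches_def)
  qed
  interpret ada_restart P n b K B fs h psi D xstar eta_min eta_max sigma_b Lbar M mu
    m alpha theta xinit eta0 state eta xr
  proof
    show "1 \<le> b" "b \<le> n" by (rule b)+
    show "fs i differentiable (at x)" if "i \<in> {1..n}" "x \<in> D" for i x
      using fs_diff[OF that(1)] that(2) D(3) by blast
    show "0 < eta_min" by (rule eta_bounds(1))
    show "psi differentiable (at x)" for x by (rule psi_diff)
    show "1 / 2 * (norm (x - y))\<^sup>2 \<le> bregman psi x y" for x y by (rule psi_sc)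
    show "proper_closed_convex h" by (rule h)
    show "\<exists>!u. is_arg_min (prox_objective h psi G e x) (\<lambda>_. True) u"
      if "x \<in> D" "e \<in> {eta_min..eta_max}" for x G e by (rule prox_unique[OF that])
    show "convex D" by (rule D(2))
    show "is_arg_min (composite n fs h) (\<lambda>_. True) xstar" using xstar(1) by (simp only: F_def)
    show "xstar \<in> D" by (rule xstar(2))
    show "1 \<le> sigma_b" by (rule sigma_b)
    show "batch_avg n b (\<lambda>S. (norm ((1 / real b) *\<^sub>R
            (\<Sum>i\<in>S. v i - (1 / real n) *\<^sub>R (\<Sum>j=1..n. v j))))\<^sup>2)
          \<le> sigma_b / (real b * real n)
              * (\<Sum>i=1..n. (norm (v i - (1 / real n) *\<^sub>R (\<Sum>j=1..n. v j)))\<^sup>2)"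
      for v :: "nat \<Rightarrow> 'a \<Rightarrow>\<^sub>L real"
      \<comment> \<open>A single batch is uniform, so the variance bound is a bound on the average over batches.\<close>
      unfolding expectation_single_batch[OF K_pos, symmetric, where t = 0]
      by (rule B_var[OF K_pos refl])
    show "0 < Lbar" by (rule L(1))
    show "bregman (avg_fun n fs) x y \<le> Lbar * bregman psi x y" if "x \<in> D" "y \<in> D" for x y
      using smooth[OF that] by (simp only: f_def)
    show "0 \<le> M" by (rule M)
    show "norm (grad (fs i) x - grad (fs i) y) \<le> M * norm (x - y)"
      if "i \<in> {1..n}" "x \<in> D" "y \<in> D" for i x y by (rule fs_lip[OF that])
    show "convex_on D (fs i)" if "i \<in> {1..n}" for i by (rule fs_convex[OF that])
    show "(norm (grad (fs i) x - grad (fs i) y))\<^sup>2 \<le> 2 * M * bregman (fs i) x y"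
      if "i \<in> {1..n}" "x \<in> D" "y \<in> D" for i x y
      unfolding bregman_def by (rule fs_cocoercive[OF that])
    show "eta_max \<le> 1 / (Lbar + 32 * sigma_b * M / real b)" by (rule eta_max_le)
    show "0 < mu" by (rule mu)
    show "ereal (mu * bregman psi xstar x) \<le> composite n fs h x - composite n fs h xstar"
      if "x \<in> D" for x using growth[OF that] by (simp only: F_def)
    show "eta0 t \<in> borel_measurable (batch_history P K B t 0)" for t by (rule eta0_meas)
    show "AE \<omega> in P. it_point (state t k \<omega>) \<in> D" if "k \<le> K" for t k by (rule x_in_D[OF that])
    show "AE \<omega> in P. it_table (state t k \<omega>) i \<in> D" if "k \<le> K" "i \<in> {1..n}" for t k i
      by (rule phi_in_D[OF that])
    show "eta_min \<le> eta t k \<omega> \<and> eta t k \<omega> \<le> eta_max" if "k < K" "\<omega> \<in> space P" for t k \<omega>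
      by (rule eta_range[OF that])
    show "eta t (k - 1) \<omega> \<le> eta t k \<omega>" if "0 < k" "k < K" "\<omega> \<in> space P" for t k \<omega>
      by (rule eta_mono[OF that])
    show "4 * ((real n / (4 * real b) + 1 / 2) + 1 / (mu * eta_min)) \<le> real K" by (rule K)
  qed (simp_all add: xr_def state_def eta_def restart_state_def)
  have gap_F: "F x = ereal (gap x + real_of_ereal (F xstar))" if "h x < \<infinity>" for x
    using that h_xstar by (simp add: F_def composite_real gap_def)
  note rate = restart_linear_rate[OF dom, of \<tau>]
  have "ereal_expectation P (\<lambda>\<omega>. F (xr \<tau> \<omega>))
      = ereal (expectation (\<lambda>\<omega>. gap (xr \<tau> \<omega>) + real_of_ereal (F xstar)))"
  proof (rule ereal_expectation_real)
    show "integrable P (\<lambda>\<omega>. gap (xr \<tau> \<omega>) + real_of_ereal (F xstar))"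
      by (simp add: xr_integrable)
    show "AE \<omega> in P. F (xr \<tau> \<omega>) = ereal (gap (xr \<tau> \<omega>) + real_of_ereal (F xstar))"
      using rate[THEN conjunct1] by eventually_elim (rule gap_F)
  qed
  also have "\<dots> = ereal (expectation (\<lambda>\<omega>. gap (xr \<tau> \<omega>)) + real_of_ereal (F xstar))"
    by (simp add: xr_integrable prob_space)
  finally have E: "ereal_expectation P (\<lambda>\<omega>. F (xr \<tau> \<omega>))
      = ereal (expectation (\<lambda>\<omega>. gap (xr \<tau> \<omega>)) + real_of_ereal (F xstar))" .
  have F_xstar: "F xstar = ereal (real_of_ereal (F xstar))"
    using gap_F[OF h_xstar] by (simp add: gap_def)
  have "ereal_expectation P (\<lambda>\<omega>. F (xr \<tau> \<omega>)) - F xstar = ereal (expectation (\<lambda>\<omega>. gap (xr \<tau> \<omega>)))"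
    by (subst F_xstar) (simp add: E)
  also have "\<dots> \<le> ereal (1 / 2 ^ \<tau>) * ereal (gap xinit)"
    using rate by simp
  also have "ereal (gap xinit) = F xinit - F xstar"
    unfolding F_def by (rule composite_gap[OF dom, symmetric])
  finally show "ereal_expectation P (\<lambda>\<omega>. F (xr \<tau> \<omega>)) - F xstar
      \<le> ereal (1 / 2 ^ \<tau>) * (F xinit - F xstar)" .
next
  case False
  \<comment> \<open>The initial gap is infinite, and the claim is trivial.\<close>
  then have "F xinit = \<infinity>"
    by (simp add: F_def composite_def not_less)
  moreover have "F xstar \<noteq> \<infinity>"
  proof -
    obtain x where "h x \<noteq> \<infinity>" using h by (auto simp: proper_closed_convex_def)
    moreover have "F xstar \<le> F x" using xstar(1) by (simp add: is_arg_min_def not_less)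
    ultimately show ?thesis by (auto simp: F_def composite_def)
  qed
  ultimately have "F xinit - F xstar = \<infinity>" by (cases "F xstar") simp_all
  then show "ereal_expectation P (\<lambda>\<omega>. F (xr \<tau> \<omega>)) - F xstar
      \<le> ereal (1 / 2 ^ \<tau>) * (F xinit - F xstar)" by simp
qed

end
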